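(* Let $H\subset\mathrm{SL}(2,\mathbb{C})$ be a finite subgroup. Then the radius $r(G)$, diameter $d(G)$, detour radius $r_D(G)$, detour diameter $d_D(G)$ and metric dimension $\dim(G)$ of the commuting graph $G=\mathcal{C}(H)$ are the following: $$ \begin{array}{|c|c|c|c|c|c|} \hline G & r(G) & d(G) & r_D(G) & d_D(G) & \dim(G) \\ \hline \mathcal{C}(\mathrm{C}_n) & 1 & 1 & n-1 & n-1 & n-1 \\ \mathcal{C}(\mathrm{BD}_{4n}) & 1 & 2 & 2n+1 & 2n+3 & 3n-2 \\ \mathcal{C}(\mathrm{BT}_{24}) & 1 & 2 & 5 & 13 & 16 \\ \mathcal{C}(\mathrm{BO}_{48}) & 1 & 2 & 7 & 19 & 34 \\ \mathcal{C}(\mathrm{BI}_{120}) & 1 & 2 & 9 & 25 & 88 \\ \hline \end{array} $$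
   Context: For a group $H$, $\mathcal{C}(H)=\mathcal{C}(H,H)$ denotes the simple graph with node set $H$ (all elements, including central ones) in which two distinct elements are joined by an edge if and only if they commute in $H$. The finite subgroups of $\mathrm{SL}(2,\mathbb{C})$ are (Klein's classification): the cyclic groups $\mathrm{C}_n$ of order $n$; the binary dihedral groups $\mathrm{BD}_{4n}=\langle\alpha,\beta\mid\alpha^{2n}=\beta^4=1,\ \alpha^n=\beta^2,\ \alpha\beta=\beta\alpha^{-1}\rangle$ of order $4n$ ($n\geq 2$); the binary tetrahedral group $\mathrm{BT}_{24}=\langle r,s,t\mid r^2=s^3=t^3=rst\rangle$ of order 24; the binary octahedral group $\mathrm{BO}_{48}=\langle r,s,t\mid r^2=s^3=t^4=rst\rangle$ of order 48; and the binary icosahedral group $\mathrm{BI}_{120}=\langle r,s,t\mid r^2=s^3=t^5=rst\rangle$ of order 120. For nodes $a,b$ of a graph $G$, $d(a,b)$ is the length of a shortest path from $a$ to $b$, and $d_D(a,b)$ is the length of a longest path from $a$ to $b$. The eccentricity $e(a)$ is the largest distance $d(a,b)$ between $a$ and any other node $b$; the diameter $d(G)$ is the greatest, and the radius $r(G)$ the smallest, eccentricity among all nodes of $G$. The detour eccentricity $e_D(a)$, detour diameter $d_D(G)$ and detour radius $r_D(G)$ are defined in the same way using $d_D(a,b)$ in place of $d(a,b)$. For an ordered subset $U=\{u_1,\ldots,u_m\}\subset V(G)$ and a node $t\in G$, the representation of $t$ with respect to $U$ is the $m$-vector $r(t|U)=(d(t,u_1),\ldots,d(t,u_m))$. The set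 $U$ is a resolving set for $G$ if any two different nodes of $G$ have different representations with respect to $U$. A basis of $G$ is a resolving set of minimum cardinality, and the metric dimension $\dim(G)$ is the cardinality of a basis.
   Formalization: The printed detour radii 5, 7, 9 for BT_24, BO_48, BI_120 are false under the given definitions and are corrected to 9, 13, 17; for C_n the radius and diameter 1 are claimed only for n ≥ 2, since the one-node graph C(C_1) has no other node. *)

theory Defs
  imports
    "HOL-Analysis.Analysis"
    "HOL-Library.Extended_Nat"
    "HOL-Algebra.Elementary_Groups"
    "Graph_Theory.Graph_Theory"
begin

section \<open>Distances, detours and resolving sets\<close>

text \<open>
  Paths are the library's \<^const>\<open>pre_digraph.apath\<close> (walks without repeated vertices); their
  length is the number of arcs. Distances and eccentricities are extended naturals, so that the
  infima and suprema below are total; in a finite connected graph they are attained, and they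
  are the minima and maxima of the usual definitions.
\<close>

definition distance :: "('a, 'b) pre_digraph \<Rightarrow> 'a \<Rightarrow> 'a \<Rightarrow> enat" where
  "distance G a b = (INF p \<in> {p. pre_digraph.apath G a p b}. enat (length p))"

definition detour_distance :: "('a, 'b) pre_digraph \<Rightarrow> 'a \<Rightarrow> 'a \<Rightarrow> enat" where
  "detour_distance G a b = (SUP p \<in> {p. pre_digraph.apath G a p b}. enat (length p))"

definition eccentricity :: "('a, 'b) pre_digraph \<Rightarrow> 'a \<Rightarrow> enat" where
  "eccentricity G a = (SUP b \<in> verts G - {a}. distance G a b)"

definition radius :: "('a, 'b) pre_digraph \<Rightarrow> enat" where
  "radius G = (INF a \<in> verts G. eccentricity G a)"

definition diam :: "('a, 'b) pre_digraph \<Rightarrow> enat" where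
  "diam G = (SUP a \<in> verts G. eccentricity G a)"

definition detour_eccentricity :: "('a, 'b) pre_digraph \<Rightarrow> 'a \<Rightarrow> enat" where
  "detour_eccentricity G a = (SUP b \<in> verts G - {a}. detour_distance G a b)"

definition detour_radius :: "('a, 'b) pre_digraph \<Rightarrow> enat" where
  "detour_radius G = (INF a \<in> verts G. detour_eccentricity G a)"

definition detour_diam :: "('a, 'b) pre_digraph \<Rightarrow> enat" where
  "detour_diam G = (SUP a \<in> verts G. detour_eccentricity G a)"

text \<open>An ordered subset of the vertices is a list of distinct vertices.\<close>

definition representation :: "('a, 'b) pre_digraph \<Rightarrow> 'a list \<Rightarrow> 'a \<Rightarrow> enat list" where
  "representation G us t = map (distance G t) us"

definition resolving :: "('a, 'b) pre_digraph \<Rightarrow> 'a list \<Rightarrow> bool" where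
  "resolving G us \<longleftrightarrow> distinct us \<and> set us \<subseteq> verts G \<and> inj_on (representation G us) (verts G)"

definition metric_dimension :: "('a, 'b) pre_digraph \<Rightarrow> nat" where
  "metric_dimension G = (LEAST m. \<exists>us. resolving G us \<and> length us = m)"


section \<open>The commuting graph of a group\<close>

definition commuting_graph :: "('a, 'm) monoid_scheme \<Rightarrow> ('a, 'a \<times> 'a) pre_digraph" where
  "commuting_graph H = with_proj
     \<lparr> pverts = carrier H,
       parcs = {(x, y). x \<in> carrier H \<and> y \<in> carrier H \<and> x \<noteq> y \<and> x \<otimes>\<^bsub>H\<^esub> y = y \<otimes>\<^bsub>H\<^esub> x} \<rparr>"

text \<open>In \<^theory>\<open>Graph_Theory.Digraph\<close>, finite simple graphs are symmetric digraphs.\<close>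

lemma graph_commuting_graph:
  assumes "finite (carrier H)"
  shows "graph (commuting_graph H)"
proof -
  let ?E = "{(x, y). x \<in> carrier H \<and> y \<in> carrier H \<and> x \<noteq> y \<and> x \<otimes>\<^bsub>H\<^esub> y = y \<otimes>\<^bsub>H\<^esub> x}"
  have "finite ?E"
    by (rule finite_subset[of _ "carrier H \<times> carrier H"]) (use assms in auto)
  then show ?thesis
    using assms unfolding commuting_graph_def
    by unfold_locales
      (auto simp: symmetric_def sym_def arcs_ends_def arc_to_ends_def with_proj_def image_iff)
qed


section \<open>Groups given by generators and relations\<close>

text \<open>
  The letter \<open>(x, True)\<close> of a word stands for the generator \<open>x\<close>, and \<open>(x, False)\<close> for its
  inverse. A relation \<open>u = v\<close> is the pair \<open>(u, v)\<close>. The presented group consists of the classes of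
  words modulo the least congruence that contains the relations and cancels a letter against its
  inverse.
\<close>

type_synonym 'g word = "('g \<times> bool) list"

inductive pres_cong :: "('g word \<times> 'g word) set \<Rightarrow> 'g word \<Rightarrow> 'g word \<Rightarrow> bool"
  for R :: "('g word \<times> 'g word) set" where
  refl: "pres_cong R u u"
| sym: "pres_cong R u v \<Longrightarrow> pres_cong R v u"
| trans: "pres_cong R u v \<Longrightarrow> pres_cong R v w \<Longrightarrow> pres_cong R u w"
| append: "pres_cong R u u' \<Longrightarrow> pres_cong R v v' \<Longrightarrow> pres_cong R (u @ v) (u' @ v')"
| cancel: "pres_cong R [(x, b), (x, \<not> b)] []"
| rel: "(u, v) \<in> R \<Longrightarrow> pres_cong R u v"

definition pres_class :: "('g word \<times> 'g word) set \<Rightarrow> 'g word \<Rightarrow> 'g word set" where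
  "pres_class R u = {v. pres_cong R u v}"

definition presented_group :: "('g word \<times> 'g word) set \<Rightarrow> 'g word set monoid" where
  "presented_group R =
     \<lparr> carrier = range (pres_class R),
       mult = (\<lambda>A B. {w. \<exists>u \<in> A. \<exists>v \<in> B. pres_cong R (u @ v) w}),
       one = pres_class R [] \<rparr>"

lemma pres_class_eq_iff: "pres_class R u = pres_class R v \<longleftrightarrow> pres_cong R u v"
  unfolding pres_class_def
  by (auto intro: pres_cong.refl pres_cong.sym pres_cong.trans)

lemma presented_group_mult:
  "pres_class R u \<otimes>\<^bsub>presented_group R\<^esub> pres_class R v = pres_class R (u @ v)"
  unfolding pres_class_def presented_group_def
  by (auto intro: pres_cong.refl pres_cong.sym pres_cong.trans pres_cong.append)

lemma pres_cong_inverse: "pres_cong R (map (\<lambda>(x, b). (x, \<not> b)) (rev u) @ u) []"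
proof (induction u)
  case Nil
  show ?case by (simp add: pres_cong.refl)
next
  case (Cons l u)
  obtain x b where l: "l = (x, b)" by (cases l)
  let ?i = "map (\<lambda>(x, b). (x, \<not> b)) (rev u)"
  have "pres_cong R ([(x, \<not> b), (x, b)] @ u) ([] @ u)"
    using pres_cong.append[OF pres_cong.cancel[of R x "\<not> b"] pres_cong.refl] by simp
  then have "pres_cong R (?i @ ([(x, \<not> b), (x, b)] @ u)) (?i @ ([] @ u))"
    by (rule pres_cong.append[OF pres_cong.refl])
  then show ?case using pres_cong.trans[OF _ Cons.IH] by (simp add: l)
qed

lemma group_presented_group: "group (presented_group R)"
proof (rule groupI)
  fix A assume "A \<in> carrier (presented_group R)"
  then obtain u where u: "A = pres_class R u" by (auto simp: presented_group_def)
  let ?i = "pres_class R (map (\<lambda>(x, b). (x, \<not> b)) (rev u))"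
  have "?i \<otimes>\<^bsub>presented_group R\<^esub> A = \<one>\<^bsub>presented_group R\<^esub>"
    unfolding u presented_group_mult
    by (simp add: presented_group_def pres_class_eq_iff pres_cong_inverse)
  moreover have "?i \<in> carrier (presented_group R)" by (simp add: presented_group_def)
  ultimately show "\<exists>B \<in> carrier (presented_group R).
      B \<otimes>\<^bsub>presented_group R\<^esub> A = \<one>\<^bsub>presented_group R\<^esub>" by blast
  show "\<one>\<^bsub>presented_group R\<^esub> \<otimes>\<^bsub>presented_group R\<^esub> A = A"
    using presented_group_mult[of R "[]" u] by (simp add: u presented_group_def)
next
  have c: "carrier (presented_group R) = range (pres_class R)"
    by (simp add: presented_group_def)
  show "\<one>\<^bsub>presented_group R\<^esub> \<in> carrier (presented_group R)"
    by (simp add: presented_group_def)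
  fix A B assume "A \<in> carrier (presented_group R)" "B \<in> carrier (presented_group R)"
  then show "A \<otimes>\<^bsub>presented_group R\<^esub> B \<in> carrier (presented_group R)"
    unfolding c by (auto simp: presented_group_mult)
  fix C assume "C \<in> carrier (presented_group R)"
  with \<open>A \<in> _\<close> \<open>B \<in> _\<close> show "A \<otimes>\<^bsub>presented_group R\<^esub> B \<otimes>\<^bsub>presented_group R\<^esub> C =
      A \<otimes>\<^bsub>presented_group R\<^esub> (B \<otimes>\<^bsub>presented_group R\<^esub> C)"
    unfolding c by (auto simp: presented_group_mult)
qed


section \<open>The finite subgroups of \<open>SL(2,\<complex>)\<close>\<close>

definition SL2C :: "(complex^2^2) monoid" where
  "SL2C = \<lparr> carrier = {A. det A = 1}, mult = (**), one = mat 1 \<rparr>"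

lemma group_SL2C: "group SL2C"
proof (rule groupI)
  fix A assume "A \<in> carrier SL2C"
  then have A: "det A = 1" by (simp add: SL2C_def)
  then have "invertible A" by (simp add: invertible_det_nz)
  then obtain B where B: "B ** A = mat 1" by (auto simp: invertible_def)
  then have "det B = 1" using det_mul[of B A] A by simp
  with B show "\<exists>B \<in> carrier SL2C. B \<otimes>\<^bsub>SL2C\<^esub> A = \<one>\<^bsub>SL2C\<^esub>"
    by (auto simp: SL2C_def)
qed (auto simp: SL2C_def det_mul matrix_mul_assoc)

abbreviation as_group :: "(complex^2^2) set \<Rightarrow> (complex^2^2) monoid" where
  "as_group H \<equiv> SL2C\<lparr>carrier := H\<rparr>"

text \<open>The cyclic group of order \<open>n \<ge> 1\<close> is the library's \<^term>\<open>integer_mod_group n\<close>.\<close>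

datatype dihedral_gen = Gen_a | Gen_b

definition binary_dihedral :: "nat \<Rightarrow> dihedral_gen word set monoid" where
  "binary_dihedral n =
     (let a = (Gen_a, True); b = (Gen_b, True); a_inv = (Gen_a, False)
      in presented_group
        {(replicate (2 * n) a, []), (replicate 4 b, []),
         (replicate n a, replicate 2 b),
         ([a, b], [b, a_inv])})"

datatype polyhedral_gen = Gen_r | Gen_s | Gen_t

text \<open>The group \<open>\<langle>r, s, t | r\<^sup>2 = s\<^sup>3 = t\<^sup>k = rst\<rangle>\<close>.\<close>

definition binary_polyhedral :: "nat \<Rightarrow> polyhedral_gen word set monoid" where
  "binary_polyhedral k =
     (let r = (Gen_r, True); s = (Gen_s, True); t = (Gen_t, True)
      in presented_group
        {(replicate 2 r, replicate 3 s), (replicate 3 s, replicate k t),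
         (replicate k t, [r, s, t])})"

definition binary_tetrahedral :: "polyhedral_gen word set monoid" where
  "binary_tetrahedral = binary_polyhedral 3"

definition binary_octahedral :: "polyhedral_gen word set monoid" where
  "binary_octahedral = binary_polyhedral 4"

definition binary_icosahedral :: "polyhedral_gen word set monoid" where
  "binary_icosahedral = binary_polyhedral 5"

end

(* Two non-scalar matrices of SL(2,C) that commute with a third non-scalar one commute with each
   other. Hence the commuting graph of a nonabelian H is the center {1, -1} joined to a disjoint
   union of cliques, and all parameters can be read off the number and the sizes of these cliques:
   a path visits at most one more clique than it has central vertices, and the cliques (and the
   center) are the classes of twins.

   For the binary dihedral groups the cliques come from the normal form of the elements.
   For <2,3,k> the element r^2 = s^3 = t^k = rst is central, hence -1, which forces r = st,
   tr s = 1, tr (st) = 0 and tr t = 1, (tr t)^2 = 2 or (tr t)^2 = tr t + 1 for k = 3, 4, 5. Then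
   1, s, t, st is a basis of the 2x2 matrices, in which right multiplication by s and t is given by
   formulas over Z[tr t], and the cliques are found by computing with integer coordinates. *)

theory Submission
  imports Defs "HOL-Algebra.Multiplicative_Group"
begin

section \<open>Distances in graphs\<close>

text \<open>The detour radii of the three polyhedral rows come out as 9, 13 and 17, where the table
  has 5, 7 and 9. A path from a central vertex can run through a largest clique, pass the second
  central vertex and run through another largest clique, so with largest cliques of size m it has 2m
  + 1 arcs; the entries of the table are m + 1. The dihedral row agrees with this count, the two
  cliques having sizes 2n - 2 and 2. An isomorphism with a presented group yields equations, but the
  presentation by itself might collapse. Concrete actions exclude this: roots of unity for the order
  of \<open>a\<close>, permutations of four or five points for st \<noteq> ts. The orders of the
  polyhedral groups are not presupposed; they result from lists of words whose values are closed, up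
  to sign, under the generators. Coordinates are integral and exact because for k = 4, 5 the
  presentation determines tr t only as one of two conjugate irrational roots, and both are treated
  at once.\<close>

lemma apath_pair_Nil:
  "pre_digraph.apath (with_proj P) a [] b \<longleftrightarrow> a \<in> pverts P \<and> a = b"
  by (auto simp: pre_digraph.apath_def pre_digraph.awalk_def
      cas_with_proj_eq awalk_verts_with_proj_eq)

lemma apath_pair_Cons:
  "pre_digraph.apath (with_proj P) a (e # p) b \<longleftrightarrow>
     e \<in> parcs P \<and> fst e = a \<and> a \<in> pverts P \<and> set p \<subseteq> parcs P \<and> pcas (snd e) p b \<and>
     a \<notin> set (pawalk_verts (snd e) p) \<and> distinct (pawalk_verts (snd e) p)"
  by (cases e) (auto simp: pre_digraph.apath_def pre_digraph.awalk_def
      cas_with_proj_eq awalk_verts_with_proj_eq)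

text \<open>Detours are counted on lists of distinct vertices, where cliques and central vertices
  can be counted with \<open>set\<close> and \<open>filter\<close>. Such a list has one more entry
  than the path has arcs.\<close>

lemma apath_vertex_list:
  assumes "pre_digraph.apath (with_proj P) a p b" and "parcs P \<subseteq> pverts P \<times> pverts P"
  shows "\<exists>xs. hd (xs :: 'a list) = a \<and> last xs = b \<and> length xs = Suc (length p) \<and> distinct xs
    \<and> set xs \<subseteq> pverts P \<and> successively (\<lambda>x y. (x, y) \<in> parcs P) xs"
proof -
  have "pcas a p b \<Longrightarrow> set p \<subseteq> parcs P \<Longrightarrow> a \<in> pverts P \<Longrightarrow>
      hd (pawalk_verts a p) = a \<and> last (pawalk_verts a p) = b \<and>
      length (pawalk_verts a p) = Suc (length p) \<and> set (pawalk_verts a p) \<subseteq> pverts P \<and>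
      successively (\<lambda>x y. (x, y) \<in> parcs P) (pawalk_verts a p)"
  proof (induction p arbitrary: a)
    case (Cons e p)
    have ne: "pawalk_verts (snd e) p \<noteq> []" by (cases p) (auto simp: split_beta)
    show ?case
      using Cons.IH[of "snd e"] Cons.prems assms(2) ne
      by (cases e) (auto simp: successively_Cons)
  qed simp
  moreover have "pcas a p b" "set p \<subseteq> parcs P" "a \<in> pverts P" "distinct (pawalk_verts a p)"
    using assms(1) by (auto simp: pre_digraph.apath_def pre_digraph.awalk_def
      cas_with_proj_eq awalk_verts_with_proj_eq)
  ultimately show ?thesis by blast
qed

lemma vertex_list_apath:
  assumes "xs \<noteq> []" "distinct xs" "set xs \<subseteq> pverts P" "successively (\<lambda>x y. (x, y) \<in> parcs P) xs"
  shows "pre_digraph.apath (with_proj P) (hd xs) (zip xs (tl xs)) (last xs)"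
proof -
  have "xs \<noteq> [] \<Longrightarrow> successively (\<lambda>x y. (x, y) \<in> parcs P) xs \<Longrightarrow>
      pcas (hd xs) (zip xs (tl xs)) (last xs) \<and> set (zip xs (tl xs)) \<subseteq> parcs P \<and>
      pawalk_verts (hd xs) (zip xs (tl xs)) = xs" for xs :: "'a list"
  proof (induction xs)
    case (Cons x xs)
    then show ?case by (cases xs) auto
  qed simp
  then show ?thesis
    using assms hd_in_set[of xs]
    by (auto simp: pre_digraph.apath_def pre_digraph.awalk_def
      cas_with_proj_eq awalk_verts_with_proj_eq)
qed

lemma distance_self:
  assumes "a \<in> pverts P"
  shows "distance (with_proj P) a a = 0"
proof -
  have "distance (with_proj P) a a \<le> 0"
    unfolding distance_def
    by (rule INF_lower2[of "[]"]) (auto simp: apath_pair_Nil zero_enat_def assms)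
  then show ?thesis by simp
qed

lemma distance_ge_one:
  "a \<noteq> b \<Longrightarrow> 1 \<le> distance (with_proj P) a b"
  unfolding distance_def
  by (rule INF_greatest) (metis apath_pair_Nil ileI1 length_0_conv mem_Collect_eq one_eSuc
      not_gr_zero enat_0_iff(1))

lemma distance_adjacent:
  assumes "(a, b) \<in> parcs P" "a \<in> pverts P" "a \<noteq> b"
  shows "distance (with_proj P) a b = 1"
proof (rule antisym)
  show "distance (with_proj P) a b \<le> 1"
    unfolding distance_def
    by (rule INF_lower2[of "[(a, b)]"]) (use assms in \<open>auto simp: apath_pair_Cons one_enat_def\<close>)
qed (rule distance_ge_one[OF assms(3)])

lemma distance_eq_two:
  assumes "(a, b) \<notin> parcs P" "(a, z) \<in> parcs P" "(z, b) \<in> parcs P"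
    and "a \<in> pverts P" "distinct [a, z, b]"
  shows "distance (with_proj P) a b = 2"
proof (rule antisym)
  show "distance (with_proj P) a b \<le> 2"
    unfolding distance_def
    by (rule INF_lower2[of "[(a, z), (z, b)]"])
      (use assms in \<open>auto simp: apath_pair_Cons numeral_eq_enat\<close>)
  show "2 \<le> distance (with_proj P) a b"
    unfolding distance_def
  proof (rule INF_greatest, clarify)
    fix p assume p: "pre_digraph.apath (with_proj P) a p b"
    have "2 \<le> length p"
    proof (cases p)
      case Nil
      then show ?thesis using p assms by (auto simp: apath_pair_Nil)
    next
      case (Cons e q)
      then show ?thesis using p assms by (cases q; cases e) (auto simp: apath_pair_Cons)
    qed
    then show "2 \<le> enat (length p)" by (simp add: numeral_eq_enat)
  qed
qed

text \<open>The end point is left free: the supremum runs over all other vertices, so any path that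
  starts at the vertex bounds it from below. Two entries guarantee that the end differs from the
  start.\<close>

lemma detour_eccentricity_ge:
  assumes "distinct xs" "set xs \<subseteq> pverts P" "successively (\<lambda>x y. (x, y) \<in> parcs P) xs"
    and "2 \<le> length xs" "Suc n \<le> length xs"
  shows "enat n \<le> detour_eccentricity (with_proj P) (hd xs)"
proof -
  from assms(4) have ne: "xs \<noteq> []" by auto
  have "hd xs \<noteq> last xs"
    using assms(1,4) by (cases xs) (auto split: if_splits)
  then have l: "last xs \<in> verts (with_proj P) - {hd xs}"
    using assms(2) last_in_set[OF ne] by auto
  have "enat n \<le> enat (length (zip xs (tl xs)))"
    using assms(5) by simp
  also have "\<dots> \<le> detour_distance (with_proj P) (hd xs) (last xs)"
    unfolding detour_distance_def
    by (rule SUP_upper) (use vertex_list_apath[OF ne] assms in auto)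
  also have "\<dots> \<le> detour_eccentricity (with_proj P) (hd xs)"
    unfolding detour_eccentricity_def by (rule SUP_upper) (rule l)
  finally show ?thesis .
qed

lemma detour_eccentricity_le:
  assumes "parcs P \<subseteq> pverts P \<times> pverts P"
    and "\<And>xs. hd xs = a \<Longrightarrow> xs \<noteq> [] \<Longrightarrow> distinct xs \<Longrightarrow> set xs \<subseteq> pverts P \<Longrightarrow>
      successively (\<lambda>x y. (x, y) \<in> parcs P) xs \<Longrightarrow> length xs \<le> Suc n"
  shows "detour_eccentricity (with_proj P) a \<le> enat n"
  unfolding detour_eccentricity_def detour_distance_def
proof (intro SUP_least)
  fix b p assume "p \<in> {p. pre_digraph.apath (with_proj P) a p b}"
  then have "pre_digraph.apath (with_proj P) a p b" by simp
  from apath_vertex_list[OF this assms(1)] obtain xs where "hd xs = a" "length xs = Suc (length p)"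
    "distinct xs" "set xs \<subseteq> pverts P" "successively (\<lambda>x y. (x, y) \<in> parcs P) xs" by blast
  then have "length xs \<le> Suc n" by (intro assms(2)) auto
  then show "enat (length p) \<le> enat n" using \<open>length xs = _\<close> by simp
qed

lemma metric_dimension_eqI:
  assumes "resolving G us" "length us = m"
    and "\<And>vs. resolving G vs \<Longrightarrow> m \<le> length vs"
  shows "metric_dimension G = m"
  unfolding metric_dimension_def by (rule Least_equality) (use assms in auto)

lemma representation_eq_iff:
  "representation G us x = representation G us y \<longleftrightarrow> (\<forall>u\<in>set us. distance G x u = distance G y u)"
  by (auto simp: representation_def)

lemma successively_distinct:
  "distinct xs \<Longrightarrow> (\<And>x y. x \<in> set xs \<Longrightarrow> y \<in> set xs \<Longrightarrow> x \<noteq> y \<Longrightarrow> Q x y) \<Longrightarrow> successively Q xs"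
proof (induction xs)
  case (Cons x xs)
  then show ?case by (cases xs) auto
qed simp

section \<open>Complete graphs, for the cyclic groups\<close>

lemma clique_parameters:
  assumes fin: "finite (pverts P)" and ne: "pverts P \<noteq> {}"
    and arcs: "\<And>x y. (x, y) \<in> parcs P \<longleftrightarrow> x \<in> pverts P \<and> y \<in> pverts P \<and> x \<noteq> y"
  shows "2 \<le> card (pverts P) \<Longrightarrow> radius (with_proj P) = 1 \<and> diam (with_proj P) = 1"
    and "detour_radius (with_proj P) = enat (card (pverts P) - 1)"
    and "detour_diam (with_proj P) = enat (card (pverts P) - 1)"
    and "metric_dimension (with_proj P) = card (pverts P) - 1"
proof -
  have d1: "distance (with_proj P) x y = 1" if "x \<in> pverts P" "y \<in> pverts P" "x \<noteq> y" for x y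
    using that by (simp add: distance_adjacent arcs)
  show "radius (with_proj P) = 1 \<and> diam (with_proj P) = 1" if "2 \<le> card (pverts P)"
  proof -
    have "eccentricity (with_proj P) a = 1" if a: "a \<in> pverts P" for a
    proof -
      have "pverts P - {a} \<noteq> {}"
        using \<open>2 \<le> card (pverts P)\<close> fin card_mono[of "{a}" "pverts P"] by auto
      then show ?thesis unfolding eccentricity_def using d1[OF a]
        by (intro SUP_eq_const) auto
    qed
    then show ?thesis using ne by (auto simp: radius_def diam_def intro!: INF_eq_const SUP_eq_const)
  qed
  have e: "detour_eccentricity (with_proj P) a = enat (card (pverts P) - 1)" if a: "a \<in> pverts P" for a
  proof (rule antisym)
    show "detour_eccentricity (with_proj P) a \<le> enat (card (pverts P) - 1)"
    proof (rule detour_eccentricity_le)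
      fix xs :: "'a list" assume "distinct xs" "set xs \<subseteq> pverts P"
      then have "length xs \<le> card (pverts P)"
        by (metis card_mono distinct_card fin)
      then show "length xs \<le> Suc (card (pverts P) - 1)" by simp
    qed (auto simp: arcs)
    obtain ys where ys: "set ys = pverts P - {a}" "distinct ys"
      using finite_distinct_list[of "pverts P - {a}"] fin by auto
    have l: "length ys = card (pverts P) - 1"
      using distinct_card[OF ys(2)] ys(1) a fin by simp
    show "enat (card (pverts P) - 1) \<le> detour_eccentricity (with_proj P) a"
    \<comment> \<open>With a single vertex the supremum runs over the empty set and is 0, in
      agreement with \<open>card (pverts P) - 1\<close>.\<close>
    proof (cases "ys = []")
      case True
      then show ?thesis using l by (simp flip: zero_enat_def)
    next
      case False
      have "successively (\<lambda>x y. (x, y) \<in> parcs P) (a # ys)"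
        using ys a by (intro successively_distinct) (auto simp: arcs)
      then show ?thesis
        using detour_eccentricity_ge[of "a # ys" P "card (pverts P) - 1"] ys a l False
        by (cases ys) auto
    qed
  qed
  show "detour_radius (with_proj P) = enat (card (pverts P) - 1)"
    "detour_diam (with_proj P) = enat (card (pverts P) - 1)"
    using ne e by (auto simp: detour_radius_def detour_diam_def intro!: INF_eq_const SUP_eq_const)
  show "metric_dimension (with_proj P) = card (pverts P) - 1"
  proof -
    obtain a where a: "a \<in> pverts P" using ne by auto
    obtain us where us: "set us = pverts P - {a}" "distinct us"
      using finite_distinct_list[of "pverts P - {a}"] fin by auto
    show ?thesis
    proof (rule metric_dimension_eqI[of _ us])
      show "length us = card (pverts P) - 1"
        using distinct_card[OF us(2)] us(1) a fin by simp
      show "resolving (with_proj P) us"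
        unfolding resolving_def
      proof (intro conjI inj_onI)
        fix x y assume x: "x \<in> verts (with_proj P)" and y: "y \<in> verts (with_proj P)"
          and xy: "representation (with_proj P) us x = representation (with_proj P) us y"
        show "x = y"
        proof (rule ccontr)
          assume "x \<noteq> y"
          \<comment> \<open>The coordinate belonging to a listed one of the two vertices is 0 for
            that vertex and 1 for the other.\<close>
          then have "x \<in> set us \<or> y \<in> set us" using us x y by auto
          then show False
            using xy d1[of x y] d1[of y x] x y \<open>x \<noteq> y\<close>
            by (auto simp: representation_eq_iff distance_self)
        qed
      qed (use us in auto)
    next
      fix vs assume vs: "resolving (with_proj P) vs"
      \<comment> \<open>Two omitted vertices would both be at distance 1 from every listed
        vertex.\<close>
      have "card (pverts P - set vs) \<le> 1"
      proof (rule ccontr)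
        assume "\<not> card (pverts P - set vs) \<le> 1"
        then obtain x y where "x \<in> pverts P - set vs" "y \<in> pverts P - set vs" "x \<noteq> y"
          using card_le_Suc0_iff_eq[of "pverts P - set vs"] fin by auto
        then show False using vs
          by (auto simp: resolving_def inj_on_def representation_eq_iff) (metis d1 subsetD)
      qed
      moreover have "card (set vs) = length vs" "set vs \<subseteq> pverts P"
        using vs by (auto simp: resolving_def distinct_card)
      ultimately show "card (pverts P) - 1 \<le> length vs"
        using card_Diff_subset[of "set vs" "pverts P"] by simp
    qed
  qed
qed

section \<open>Cliques joined to a center of order two\<close>

text \<open>The lower bound on the sizes serves twice: \<open>card\<close> of an infinite set is 0,
  so the cliques are finite; and a clique that loses one vertex still offers another one to a
  resolving set.\<close>

locale central_cliques =
  fixes P :: "'a pair_pre_digraph" and Z :: "'a set" and I :: "'i set" and B :: "'i \<Rightarrow> 'a set"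
  assumes finite_I: "finite I"
    and card_Z: "card Z = 2"
    and disjoint: "disjoint_family_on B I" and disjoint_Z: "\<And>i. i \<in> I \<Longrightarrow> Z \<inter> B i = {}"
    and card_B: "\<And>i. i \<in> I \<Longrightarrow> 2 \<le> card (B i)"
    and pverts: "pverts P = Z \<union> (\<Union>i\<in>I. B i)"
    and parcs: "\<And>x y. x \<in> pverts P \<Longrightarrow> y \<in> pverts P \<Longrightarrow>
      (x, y) \<in> parcs P \<longleftrightarrow> x \<noteq> y \<and> (x \<in> Z \<or> y \<in> Z \<or> (\<exists>i\<in>I. x \<in> B i \<and> y \<in> B i))"
    and parcs_subset: "parcs P \<subseteq> pverts P \<times> pverts P"
begin

lemma finite_B: "i \<in> I \<Longrightarrow> finite (B i)"
  using card_B by (metis card.infinite not_numeral_le_zero)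

lemma finite_Z: "finite Z"
  using card_Z by (metis card.infinite zero_neq_numeral)

lemma finite_pverts: "finite (pverts P)"
  by (simp add: pverts finite_Z finite_I finite_B)

lemma block_unique: "i \<in> I \<Longrightarrow> j \<in> I \<Longrightarrow> x \<in> B i \<Longrightarrow> x \<in> B j \<Longrightarrow> i = j"
  using disjoint by (auto simp: disjoint_family_on_def)

lemma not_central: "i \<in> I \<Longrightarrow> x \<in> B i \<Longrightarrow> x \<notin> Z"
  using disjoint_Z by auto

lemma distance_cases:
  assumes "x \<in> pverts P" "y \<in> pverts P"
  shows "distance (with_proj P) x y =
    (if x = y then 0 else if (x, y) \<in> parcs P then 1 else 2)"
proof -
  obtain z where z: "z \<in> Z" using card_Z by fastforce
  then have "z \<in> pverts P" by (simp add: pverts)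
  have "distance (with_proj P) x y = 2" if "x \<noteq> y" "(x, y) \<notin> parcs P"
  proof -
    have "x \<noteq> z" "y \<noteq> z" using that z assms by (auto simp: parcs)
    then show ?thesis
      using that z assms \<open>z \<in> pverts P\<close> by (intro distance_eq_two[of _ _ _ z]) (auto simp: parcs)
  qed
  then show ?thesis using assms by (auto simp: distance_self distance_adjacent)
qed

lemma eccentricity_central:
  assumes "z \<in> Z"
  shows "eccentricity (with_proj P) z = 1"
proof -
  have z: "z \<in> pverts P" using assms by (simp add: pverts)
  have "pverts P - {z} \<noteq> {}"
  proof
    assume "pverts P - {z} = {}"
    then have "Z \<subseteq> {z}" by (auto simp: pverts)
    then show False using card_Z card_mono[of "{z}" Z] by simp
  qed
  then show ?thesis
    unfolding eccentricity_def
    using assms z by (intro SUP_eq_const) (auto simp: distance_cases parcs)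
qed

lemma radius: "radius (with_proj P) = 1"
proof (rule antisym)
  obtain z where z: "z \<in> Z" using card_Z by fastforce
  then show "radius (with_proj P) \<le> 1"
    unfolding radius_def
    by (intro INF_lower2[of z]) (auto simp: eccentricity_central pverts)
  show "1 \<le> radius (with_proj P)"
    unfolding radius_def
  proof (rule INF_greatest)
    fix a assume a: "a \<in> verts (with_proj P)"
    obtain z where z: "z \<in> Z" "z \<noteq> a"
      using card_Z by (metis card_2_iff insert_iff)
    then show "1 \<le> eccentricity (with_proj P) a"
      unfolding eccentricity_def using distance_ge_one[of a z P]
      by (intro SUP_upper2[of z]) (auto simp: pverts)
  qed
qed

lemma diam:
  assumes "i \<in> I" "j \<in> I" "i \<noteq> j"
  shows "diam (with_proj P) = 2"
proof (rule antisym)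
  show "diam (with_proj P) \<le> 2"
    unfolding diam_def eccentricity_def
    by (intro SUP_least) (auto simp: distance_cases)
  obtain x y where xy: "x \<in> B i" "y \<in> B j" using card_B assms
    by (metis card.empty equals0I not_numeral_le_zero)
  then have v: "x \<in> pverts P" "y \<in> pverts P" "x \<noteq> y"
    using assms block_unique[of i j] by (auto simp: pverts)
  then have "(x, y) \<notin> parcs P"
    using xy assms block_unique not_central by (metis parcs)
  with v show "2 \<le> diam (with_proj P)"
    unfolding diam_def eccentricity_def
    by (intro SUP_upper2[of x] SUP_upper2[of y]) (auto simp: distance_cases)
qed

text \<open>A path can only change its clique by passing through a central vertex.\<close>

lemma card_blocks_visited:
  assumes "set xs \<subseteq> pverts P" "successively (\<lambda>x y. (x, y) \<in> parcs P) xs"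
  shows "card {i \<in> I. B i \<inter> set xs \<noteq> {}} \<le>
    length (filter (\<lambda>x. x \<in> Z) xs) + (if xs = [] \<or> hd xs \<in> Z then 0 else 1)"
  using assms
\<comment> \<open>An arc between noncentral vertices stays in one clique. So each new clique is
  charged to the central vertex just before it; a clique at the head of the list has none, which is
  the extra 1.\<close>
proof (induction xs)
  case (Cons x xs)
  let ?K = "\<lambda>xs. {i \<in> I. B i \<inter> set xs \<noteq> {}}"
  have IH: "card (?K xs) \<le> length (filter (\<lambda>x. x \<in> Z) xs) + (if xs = [] \<or> hd xs \<in> Z then 0 else 1)"
    using Cons by (auto simp: successively_Cons)
  show ?case
  proof (cases "x \<in> Z")
    case True
    then have "?K (x # xs) = ?K xs" using not_central by auto
    then show ?thesis using IH True by (auto split: if_splits)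
  next
    case False
    then obtain i where i: "i \<in> I" "x \<in> B i" using Cons.prems by (auto simp: pverts)
    have K: "?K (x # xs) = insert i (?K xs)" using i block_unique by auto
    show ?thesis
    proof (cases "xs = [] \<or> hd xs \<in> Z")
      case True
      then show ?thesis using IH False K finite_I by (auto simp: card_insert_if)
    next
      case hd: False
      then have "(x, hd xs) \<in> parcs P" "hd xs \<in> pverts P"
        using Cons.prems by (auto simp: successively_Cons)
      then obtain j where "j \<in> I" "x \<in> B j" "hd xs \<in> B j"
        using hd False Cons.prems by (auto simp: parcs)
      then have "hd xs \<in> B i" using block_unique i by blast
      then have "i \<in> ?K xs" using i hd by auto
      then have "?K (x # xs) = ?K xs" using K by auto
      then show ?thesis using IH hd False by simp
    qed
  qed
qed simp

text \<open>A path contains at most two central vertices, hence meets at most two cliques, or three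
  if it starts in one. The premise on \<open>K\<close> postpones the question which cliques are the
  best choice.\<close>

lemma path_length_le:
  assumes xs: "distinct xs" "set xs \<subseteq> pverts P" "successively (\<lambda>x y. (x, y) \<in> parcs P) xs"
    and le: "\<And>K. K \<subseteq> I \<Longrightarrow> card K \<le> (if hd xs \<in> Z then 2 else 3) \<Longrightarrow> (\<Sum>i\<in>K. card (B i)) \<le> m"
  shows "length xs \<le> m + 2"
proof -
  define K where "K = {i \<in> I. B i \<inter> set xs \<noteq> {}}"
  have "length (filter (\<lambda>x. x \<in> Z) xs) = card (set (filter (\<lambda>x. x \<in> Z) xs))"
    using xs(1) by (simp only: distinct_card distinct_filter)
  also have "\<dots> \<le> card Z" by (rule card_mono) (auto simp: finite_Z)
  finally have Z: "length (filter (\<lambda>x. x \<in> Z) xs) \<le> 2" using card_Z by simp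
  then have "card K \<le> (if hd xs \<in> Z then 2 else 3)"
    using card_blocks_visited[OF xs(2,3)] unfolding K_def by (auto split: if_splits)
  then have m: "(\<Sum>i\<in>K. card (B i)) \<le> m" by (intro le) (auto simp: K_def)
  have "length xs = card (set xs)" using xs(1) by (simp add: distinct_card)
  also have "\<dots> \<le> card (Z \<union> (\<Union>i\<in>K. B i))"
    by (rule card_mono) (use xs(2) in \<open>auto simp: K_def pverts finite_Z finite_I finite_B\<close>)
  also have "\<dots> \<le> card Z + card (\<Union>i\<in>K. B i)" by (rule card_Un_le)
  also have "card (\<Union>i\<in>K. B i) \<le> (\<Sum>i\<in>K. card (B i))"
    by (rule card_UN_le) (auto simp: K_def finite_I)
  finally show ?thesis using m card_Z by simp
qed

text \<open>The bound for central starts is attained by \<open>z\<close>, a whole clique, the other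
  central vertex and another whole clique, in this order.\<close>

lemma path_from_central:
  assumes "z \<in> Z" "j \<in> I" "k \<in> I" "j \<noteq> k"
  shows "\<exists>xs. hd xs = z \<and> length xs = card (B j) + card (B k) + 2 \<and> distinct xs
    \<and> set xs = Z \<union> B j \<union> B k \<and> successively (\<lambda>x y. (x, y) \<in> parcs P) xs"
proof -
  obtain z' where z': "Z = {z, z'}" "z \<noteq> z'"
    using card_Z assms(1) by (auto simp: card_2_iff)
  obtain us vs where us: "set us = B j" "distinct us" and vs: "set vs = B k" "distinct vs"
    using finite_distinct_list finite_B assms by metis
  have "us \<noteq> []" "vs \<noteq> []" using us vs card_B assms by fastforce+
  have sub: "Z \<subseteq> pverts P" "B j \<subseteq> pverts P" "B k \<subseteq> pverts P" using assms by (auto simp: pverts)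
  have "successively (\<lambda>x y. (x, y) \<in> parcs P) us" "successively (\<lambda>x y. (x, y) \<in> parcs P) vs"
    using us vs sub assms by (auto intro!: successively_distinct simp: parcs subset_iff)
  moreover have "hd us \<in> B j" "last us \<in> B j" "hd vs \<in> B k"
    using us vs \<open>us \<noteq> []\<close> \<open>vs \<noteq> []\<close> by auto
  moreover from this have "(z, hd us) \<in> parcs P" "(last us, z') \<in> parcs P" "(z', hd vs) \<in> parcs P"
    using sub z' not_central[OF assms(2)] not_central[OF assms(3)] by (auto simp: parcs subsetD)
  ultimately have "successively (\<lambda>x y. (x, y) \<in> parcs P) (z # us @ z' # vs)"
    using \<open>us \<noteq> []\<close> by (simp add: successively_Cons successively_append_iff)
  moreover have "distinct (z # us @ z' # vs)"
    using us vs z' not_central block_unique assms by auto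
  moreover have "length (z # us @ z' # vs) = card (B j) + card (B k) + 2"
    using us vs by (simp flip: distinct_card)
  ultimately show ?thesis using us vs z'
    by (intro exI[of _ "z # us @ z' # vs"]) auto
qed

text \<open>A noncentral start gains its own clique: this is run through first, and a path from a
  central vertex follows.\<close>

lemma path_from_block:
  assumes "a \<in> B i" "i \<in> I" "j \<in> I" "k \<in> I" "distinct [i, j, k]"
  shows "\<exists>xs. hd xs = a \<and> length xs = card (B i) + card (B j) + card (B k) + 2 \<and> distinct xs
    \<and> set xs \<subseteq> pverts P \<and> successively (\<lambda>x y. (x, y) \<in> parcs P) xs"
proof -
  obtain z where z: "z \<in> Z" using card_Z by fastforce
  then obtain xs where xs: "hd xs = z" "length xs = card (B j) + card (B k) + 2" "distinct xs"
    "set xs = Z \<union> B j \<union> B k" "successively (\<lambda>x y. (x, y) \<in> parcs P) xs"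
    using path_from_central[of z j k] assms by auto
  obtain us where us: "set us = B i - {a}" "distinct us"
    using finite_distinct_list[of "B i - {a}"] finite_B assms by auto
  have l: "length (a # us) = card (B i)"
    using us assms finite_B by (simp flip: distinct_card add: card_Diff_singleton)
      (metis Suc_pred card_gt_0_iff empty_iff)
  have s: "set (a # us) = B i" using us assms by auto
  have sub: "Z \<subseteq> pverts P" "B i \<subseteq> pverts P" "B j \<subseteq> pverts P" "B k \<subseteq> pverts P"
    using assms by (auto simp: pverts)
  have d: "distinct (a # us)" using us by simp
  have "successively (\<lambda>x y. (x, y) \<in> parcs P) (a # us)"
    using s d sub assms by (intro successively_distinct) (auto simp: parcs subset_iff)
  moreover have "last (a # us) \<in> B i" using s by (metis last_in_set list.distinct(1))
  moreover from this have "(last (a # us), hd xs) \<in> parcs P"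
    using sub xs(1) z not_central[OF assms(2)] by (metis parcs subsetD)
  ultimately have "successively (\<lambda>x y. (x, y) \<in> parcs P) ((a # us) @ xs)"
    using xs(5) unfolding successively_append_iff by blast
  moreover have "distinct ((a # us) @ xs)"
    unfolding distinct_append using d xs s not_central block_unique assms by auto
  ultimately show ?thesis
    using l xs s sub by (intro exI[of _ "(a # us) @ xs"]) auto
qed

text \<open>Each clique, and the center, is a set of twins: a resolving set omits at most one of them.\<close>

lemma metric_dimension:
  assumes "2 \<le> card I"
  shows "metric_dimension (with_proj P) = card (pverts P) - (card I + 1)"
proof -
  define twins where "twins = (\<lambda>T. \<forall>x\<in>T. \<forall>y\<in>T. \<forall>u\<in>pverts P. u \<noteq> x \<longrightarrow> u \<noteq> y \<longrightarrow>
      distance (with_proj P) x u = distance (with_proj P) y u)"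
  have twins_B: "twins (B i)" if "i \<in> I" for i
    unfolding twins_def
  proof (intro ballI impI)
    fix x y u assume *: "x \<in> B i" "y \<in> B i" "u \<in> pverts P" "u \<noteq> x" "u \<noteq> y"
    then have "x \<in> pverts P" "y \<in> pverts P" "x \<notin> Z" "y \<notin> Z"
      using that not_central by (auto simp: pverts)
    then show "distance (with_proj P) x u = distance (with_proj P) y u"
      using * that block_unique by (auto simp: distance_cases parcs)
  qed
  have twins_Z: "twins Z"
    unfolding twins_def
  proof (intro ballI impI)
    fix x y u assume *: "x \<in> Z" "y \<in> Z" "u \<in> pverts P" "u \<noteq> x" "u \<noteq> y"
    then have "x \<in> pverts P" "y \<in> pverts P" by (auto simp: pverts)
    then show "distance (with_proj P) x u = distance (with_proj P) y u"
      using * by (auto simp: distance_cases parcs)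
  qed
  define C where "C = insert Z (B ` I)"
  have C_cover: "\<Union>C = pverts P" by (auto simp: C_def pverts)
  have C_twins: "twins T" if "T \<in> C" for T using that twins_B twins_Z by (auto simp: C_def)
  have inj_B: "inj_on B I"
    using card_B block_unique by (intro inj_onI) (metis card.empty equals0I not_numeral_le_zero)
  have "Z \<notin> B ` I" using card_Z disjoint_Z by fastforce
  then have card_C: "card C = card I + 1"
    using inj_B finite_I by (simp add: C_def card_image)
  have C_disj: "S \<inter> T = {}" if "S \<in> C" "T \<in> C" "S \<noteq> T" for S T
  proof -
    have "B i \<inter> B j = {}" if "i \<in> I" "j \<in> I" "B i \<noteq> B j" for i j
      using that block_unique by blast
    moreover have "Z \<inter> B i = {}" "B i \<inter> Z = {}" if "i \<in> I" for i
      using that disjoint_Z by auto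
    ultimately show ?thesis using that unfolding C_def by blast
  qed
  have C_card: "2 \<le> card T" if "T \<in> C" for T
    using that card_B card_Z by (auto simp: C_def)
  have C_fin: "finite C" using finite_I by (simp add: C_def)
  obtain f where f: "\<And>T. T \<in> C \<Longrightarrow> f T \<in> T"
    using C_card by (metis card.empty equals0I not_numeral_le_zero)
  have f_inj: "inj_on f C" using f C_disj by (intro inj_onI) (metis IntI emptyE)
  have f_sub: "f ` C \<subseteq> pverts P" unfolding C_cover[symmetric] using f by (intro image_subsetI) (rule UnionI)
  obtain us where us: "set us = pverts P - f ` C" "distinct us"
    using finite_distinct_list[of "pverts P - f ` C"] finite_pverts by auto
  show ?thesis
  proof (rule metric_dimension_eqI[of _ us])
    show "length us = card (pverts P) - (card I + 1)"
      using distinct_card[OF us(2)] us(1) card_Diff_subset[OF finite_imageI[OF C_fin] f_sub]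
      by (simp add: card_image f_inj card_C)
    show "resolving (with_proj P) us"
      unfolding resolving_def
    proof (intro conjI inj_onI)
      \<comment> \<open>A clique has at least two vertices and loses only its representative, so one
        of them stays in the list.\<close>
      have block: "\<exists>u\<in>set us. u \<in> B j" if "j \<in> I" for j
      proof -
        have "B j \<in> C" using that by (simp add: C_def)
        have "\<not> B j \<subseteq> {f (B j)}"
          using card_mono[of "{f (B j)}" "B j"] card_B[OF that] by auto
        then obtain u where u: "u \<in> B j" "u \<noteq> f (B j)" by blast
        then have "u \<notin> f ` C" using C_disj[OF \<open>B j \<in> C\<close>] f by blast
        then show ?thesis using u us that by (auto simp: pverts)
      qed
      \<comment> \<open>A listed vertex of clique \<open>j\<close> is at distance 2 from
        \<open>x\<close> but at distance 1 from \<open>y\<close>.\<close>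
      have sep: False if x: "x \<in> pverts P" "x \<notin> set us" and y: "y \<in> pverts P" "y \<notin> set us"
        and xy: "representation (with_proj P) us x = representation (with_proj P) us y"
        and j: "j \<in> I" "x \<notin> B j" "x \<notin> Z" "y \<in> B j \<or> y \<in> Z" for x y j
      proof -
        obtain u where u: "u \<in> set us" "u \<in> B j" using block[OF j(1)] by blast
        then have "u \<in> pverts P" "u \<notin> Z" using us not_central j by auto
        then have "distance (with_proj P) x u = 2"
          using u x j block_unique by (auto simp: distance_cases parcs)
        moreover have "distance (with_proj P) y u = 1"
          using u y j \<open>u \<in> pverts P\<close> by (auto simp: distance_cases parcs)
        ultimately show False using xy u by (auto simp: representation_eq_iff)
      qed
      fix x y assume x: "x \<in> verts (with_proj P)" and y: "y \<in> verts (with_proj P)"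
        and xy: "representation (with_proj P) us x = representation (with_proj P) us y"
      show "x = y"
      proof (rule ccontr)
        assume ne: "x \<noteq> y"
        have *: "distance (with_proj P) x u = distance (with_proj P) y u" if "u \<in> set us" for u
          using xy that by (simp add: representation_eq_iff)
        have "distance (with_proj P) x y \<noteq> 0" "distance (with_proj P) y x \<noteq> 0"
          using ne distance_ge_one[of y x P] distance_ge_one[of x y P] by fastforce+
        then have nus: "x \<notin> set us" "y \<notin> set us"
          using *[of x] *[of y] x y by (auto simp: distance_self)
        then have "x \<in> f ` C" "y \<in> f ` C" using us(1) x y by auto
        then obtain S T where ST: "S \<in> C" "T \<in> C" "x = f S" "y = f T" by blast
        then have "S \<noteq> T" "x \<in> S" "y \<in> T" using ne f by blast+
        then consider (xZ) i where "x \<in> Z" "i \<in> I" "y \<in> B i" | (yZ) i where "y \<in> Z" "i \<in> I" "x \<in> B i"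
          | (blocks) i j where "i \<in> I" "j \<in> I" "i \<noteq> j" "x \<in> B i" "y \<in> B j"
          using ST(1,2) unfolding C_def by blast
        then show False
        proof cases
          case xZ
          \<comment> \<open>The listed vertices in the clique of \<open>y\<close> are at distance 1
            from both \<open>x\<close> and \<open>y\<close>. Only a second clique separates them,
            which is why \<open>I\<close> must have two elements.\<close>
          have "\<not> I \<subseteq> {i}" using assms card_mono[of "{i}" I] by auto
          then obtain j where "j \<in> I" "j \<noteq> i" by blast
          then show False using sep[of y x j] nus x y xy xZ block_unique not_central by auto
        next
          case yZ
          have "\<not> I \<subseteq> {i}" using assms card_mono[of "{i}" I] by auto
          then obtain j where "j \<in> I" "j \<noteq> i" by blast
          then show False using sep[of x y j] nus x y xy yZ block_unique not_central by auto
        next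
          case blocks
          then show False using sep[of x y j] nus x y xy block_unique not_central by auto
        qed
      qed
    qed (use us in auto)
  next
    fix vs assume vs: "resolving (with_proj P) vs"
    let ?N = "pverts P - set vs"
    have "\<forall>x\<in>?N. \<exists>T\<in>C. x \<in> T" using C_cover by auto
    then obtain g where g: "\<And>x. x \<in> ?N \<Longrightarrow> g x \<in> C \<and> x \<in> g x" by metis
    have "inj_on g ?N"
    proof (rule inj_onI)
      fix x y assume xy: "x \<in> ?N" "y \<in> ?N" "g x = g y"
      then have "twins (g x)" "x \<in> g x" "y \<in> g x" using g C_twins by auto
      then have "representation (with_proj P) vs x = representation (with_proj P) vs y"
        using xy(1,2) vs unfolding twins_def representation_eq_iff resolving_def
        by (metis DiffD2 subsetD with_proj_simps(1))
      then show "x = y" using vs xy by (auto simp: resolving_def inj_on_def)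
    qed
    then have "card ?N \<le> card C" using g C_fin by (intro card_inj_on_le[of g]) auto
    moreover have "card (set vs) = length vs" "set vs \<subseteq> pverts P"
      using vs by (auto simp: resolving_def distinct_card)
    ultimately show "card (pverts P) - (card I + 1) \<le> length vs"
      using card_Diff_subset[of "set vs" "pverts P"] card_C by simp
  qed
qed

end

section \<open>Detour radius and detour diameter from the three largest cliques\<close>

locale three_largest_cliques = central_cliques +
  fixes j1 j2 j3
  assumes j_in: "j1 \<in> I" "j2 \<in> I" "j3 \<in> I" and j_distinct: "distinct [j1, j2, j3]"
    and j_le: "card (B j3) \<le> card (B j2)" "card (B j2) \<le> card (B j1)"
    and j_max: "\<And>i. i \<in> I - {j1, j2} \<Longrightarrow> card (B i) \<le> card (B j3)"
begin

text \<open>An exchange argument: each member of \<open>K\<close> other than \<open>j1\<close> and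
  \<open>j2\<close> contributes at most \<open>card (B j3)\<close>, and is outweighed by whichever
  of \<open>j1\<close>, \<open>j2\<close> is missing from \<open>K\<close>.\<close>

lemma sum_card_le:
  assumes "K \<subseteq> I" "card K \<le> n" "n = 2 \<or> n = 3"
  shows "(\<Sum>i\<in>K. card (B i)) \<le> card (B j1) + card (B j2) + (if n = 2 then 0 else card (B j3))"
proof -
  have fin: "finite K" using assms finite_I finite_subset by blast
  define K' where "K' = K - {j1, j2}"
  have K: "K = K' \<union> (K \<inter> {j1, j2})" by (auto simp: K'_def)
  have "card K = card K' + card (K \<inter> {j1, j2})"
    by (subst K, subst card_Un_disjoint) (auto simp: K'_def fin)
  moreover have "(\<Sum>i\<in>K. card (B i)) = (\<Sum>i\<in>K'. card (B i)) + (\<Sum>i\<in>K \<inter> {j1, j2}. card (B i))"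
    by (subst K, subst sum.union_disjoint) (auto simp: K'_def fin)
  moreover have "(\<Sum>i\<in>K'. card (B i)) \<le> card K' * card (B j3)"
    using sum_bounded_above[of K' "\<lambda>i. card (B i)" "card (B j3)"] j_max assms(1)
    by (auto simp: K'_def)
  \<comment> \<open>\<open>c\<close> is the number of places that remain in \<open>K\<close> for
    cliques other than \<open>j1\<close> and \<open>j2\<close>.\<close>
  ultimately have *: "(\<Sum>i\<in>K. card (B i)) \<le> c * card (B j3) + (\<Sum>i\<in>K \<inter> {j1, j2}. card (B i))"
    if "n \<le> c + card (K \<inter> {j1, j2})" for c
    using that assms(2) mult_right_mono[of "card K'" c "card (B j3)"] by linarith
  have ne: "j1 \<noteq> j2" using j_distinct by simp
  consider "j1 \<in> K" "j2 \<in> K" "K \<inter> {j1, j2} = {j1, j2}" | "j1 \<in> K" "K \<inter> {j1, j2} = {j1}"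
    | "j2 \<in> K" "K \<inter> {j1, j2} = {j2}" | "K \<inter> {j1, j2} = {}" by blast
  then show ?thesis
  proof cases
    case 1
    then show ?thesis using *[of "n - 2", unfolded 1(3)] ne assms(3) by auto
  next
    case 2
    then show ?thesis using *[of "n - 1", unfolded 2(2)] j_le assms(3) by auto
  next
    case 3
    then show ?thesis using *[of "n - 1", unfolded 3(2)] j_le assms(3) by auto
  next
    case 4
    then show ?thesis using *[of n] j_le assms(3) by auto
  qed
qed

lemma detour_eccentricity_central:
  assumes "z \<in> Z"
  shows "detour_eccentricity (with_proj P) z = enat (card (B j1) + card (B j2) + 1)"
proof (rule antisym)
  show "detour_eccentricity (with_proj P) z \<le> enat (card (B j1) + card (B j2) + 1)"
  proof (rule detour_eccentricity_le[OF parcs_subset])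
    fix xs assume *: "hd xs = z" "distinct xs" "set xs \<subseteq> pverts P"
      "successively (\<lambda>x y. (x, y) \<in> parcs P) xs"
    show "length xs \<le> Suc (card (B j1) + card (B j2) + 1)"
      using path_length_le[OF *(2-4), of "card (B j1) + card (B j2)"] sum_card_le[of _ 2] assms *(1)
      by auto
  qed
  obtain xs where "hd xs = z" "length xs = card (B j1) + card (B j2) + 2" "distinct xs"
    "set xs = Z \<union> B j1 \<union> B j2" "successively (\<lambda>x y. (x, y) \<in> parcs P) xs"
    using path_from_central[OF assms, of j1 j2] j_in j_distinct by auto
  then show "enat (card (B j1) + card (B j2) + 1) \<le> detour_eccentricity (with_proj P) z"
    using detour_eccentricity_ge[of xs P "card (B j1) + card (B j2) + 1"] j_in
    by (simp add: pverts UN_upper le_supI1 le_supI2)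
qed

text \<open>The estimate is uniform in the start, central vertices included, so that it bounds the
  detour diameter.\<close>

lemma detour_eccentricity_block_le:
  "detour_eccentricity (with_proj P) a \<le> enat (card (B j1) + card (B j2) + card (B j3) + 1)"
proof (rule detour_eccentricity_le[OF parcs_subset])
  fix xs assume *: "distinct xs" "set xs \<subseteq> pverts P"
    "successively (\<lambda>x y. (x, y) \<in> parcs P) xs"
  have "(\<Sum>i\<in>K. card (B i)) \<le> card (B j1) + card (B j2) + card (B j3)"
    if "K \<subseteq> I" "card K \<le> (if hd xs \<in> Z then 2 else 3)" for K
    using sum_card_le[of K 3] that by (auto split: if_splits)
  from path_length_le[OF * this]
  show "length xs \<le> Suc (card (B j1) + card (B j2) + card (B j3) + 1)" by simp
qed

lemma detour_eccentricity_block_ge: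
  assumes "a \<in> B i" "i \<in> I" "j \<in> I" "k \<in> I" "distinct [i, j, k]"
    and "n \<le> card (B i) + card (B j) + card (B k) + 1"
  shows "enat n \<le> detour_eccentricity (with_proj P) a"
proof -
  obtain xs where xs: "hd xs = a" "length xs = card (B i) + card (B j) + card (B k) + 2"
    "distinct xs" "set xs \<subseteq> pverts P" "successively (\<lambda>x y. (x, y) \<in> parcs P) xs"
    using path_from_block[OF assms(1-5)] by blast
  show ?thesis
    using detour_eccentricity_ge[OF xs(3,4,5), of n] xs(1,2) assms(6) by simp
qed

lemma detour_diam:
  "detour_diam (with_proj P) = enat (card (B j1) + card (B j2) + card (B j3) + 1)"
proof (rule antisym)
  show "detour_diam (with_proj P) \<le> enat (card (B j1) + card (B j2) + card (B j3) + 1)"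
    unfolding detour_diam_def by (intro SUP_least detour_eccentricity_block_le)
  obtain a where a: "a \<in> B j1"
    using card_B[OF j_in(1)] by fastforce
  then show "enat (card (B j1) + card (B j2) + card (B j3) + 1) \<le> detour_diam (with_proj P)"
    unfolding detour_diam_def
    using detour_eccentricity_block_ge[OF a j_in(1,2,3)] j_distinct j_in
    by (intro SUP_upper2[of a]) (auto simp: pverts)
qed

text \<open>The minimum is taken at the center. From a vertex of clique \<open>i\<close> there is a
  path through three whole cliques, one of them \<open>i\<close>, and the other two can be chosen so
  that \<open>j1\<close> and \<open>j2\<close> are among the three.\<close>

lemma detour_radius:
  "detour_radius (with_proj P) = enat (card (B j1) + card (B j2) + 1)"
proof (rule antisym)
  obtain z where z: "z \<in> Z" using card_Z by fastforce
  then show "detour_radius (with_proj P) \<le> enat (card (B j1) + card (B j2) + 1)"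
    unfolding detour_radius_def
    by (intro INF_lower2[of z]) (auto simp: pverts detour_eccentricity_central)
  show "enat (card (B j1) + card (B j2) + 1) \<le> detour_radius (with_proj P)"
    unfolding detour_radius_def
  proof (rule INF_greatest)
    fix a assume "a \<in> verts (with_proj P)"
    then consider "a \<in> Z" | i where "i \<in> I" "a \<in> B i" by (auto simp: pverts)
    then show "enat (card (B j1) + card (B j2) + 1) \<le> detour_eccentricity (with_proj P) a"
    proof cases
      case 1
      then show ?thesis by (simp add: detour_eccentricity_central)
    next
      case 2
      consider "i = j1" | "i = j2" | "i \<noteq> j1" "i \<noteq> j2" by blast
      then show ?thesis
      proof cases
        case 1
        then show ?thesis
          using 2 j_in j_distinct by (intro detour_eccentricity_block_ge[of a i j2 j3]) auto
      next
        case i: 2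
        then show ?thesis
          using 2 j_in j_distinct by (intro detour_eccentricity_block_ge[of a i j1 j3]) auto
      next
        case 3
        then show ?thesis
          using 2 j_in j_distinct by (intro detour_eccentricity_block_ge[of a i j1 j2]) auto
      qed
    qed
  qed
qed

end

section \<open>Commuting graphs and presentations\<close>

lemma commuting_graph_with_proj:
  "commuting_graph K = with_proj \<lparr>pverts = carrier K,
     parcs = {(x, y). x \<in> carrier K \<and> y \<in> carrier K \<and> x \<noteq> y \<and> x \<otimes>\<^bsub>K\<^esub> y = y \<otimes>\<^bsub>K\<^esub> x}\<rparr>"
  by (simp add: commuting_graph_def)

lemma commuting_graph_commutative:
  assumes fin: "finite (carrier K)" and ne: "carrier K \<noteq> {}"
    and comm: "\<And>x y. x \<in> carrier K \<Longrightarrow> y \<in> carrier K \<Longrightarrow> x \<otimes>\<^bsub>K\<^esub> y = y \<otimes>\<^bsub>K\<^esub> x"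
  shows "2 \<le> card (carrier K) \<Longrightarrow> radius (commuting_graph K) = 1 \<and> diam (commuting_graph K) = 1"
    and "detour_radius (commuting_graph K) = enat (card (carrier K) - 1)"
    and "detour_diam (commuting_graph K) = enat (card (carrier K) - 1)"
    and "metric_dimension (commuting_graph K) = card (carrier K) - 1"
proof -
  let ?P = "\<lparr>pverts = carrier K,
     parcs = {(x, y). x \<in> carrier K \<and> y \<in> carrier K \<and> x \<noteq> y \<and> x \<otimes>\<^bsub>K\<^esub> y = y \<otimes>\<^bsub>K\<^esub> x}\<rparr>"
  have *: "finite (pverts ?P)" "pverts ?P \<noteq> {}"
    "\<And>x y. (x, y) \<in> parcs ?P \<longleftrightarrow> x \<in> pverts ?P \<and> y \<in> pverts ?P \<and> x \<noteq> y"
    using assms by auto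
  show "2 \<le> card (carrier K) \<Longrightarrow> radius (commuting_graph K) = 1 \<and> diam (commuting_graph K) = 1"
    "detour_radius (commuting_graph K) = enat (card (carrier K) - 1)"
    "detour_diam (commuting_graph K) = enat (card (carrier K) - 1)"
    "metric_dimension (commuting_graph K) = card (carrier K) - 1"
    unfolding commuting_graph_with_proj using clique_parameters[OF *] by simp_all
qed

lemma commuting_graph_cliques:
  fixes I :: "'i set" and K :: "('a, 'b) monoid_scheme"
  assumes fin: "finite I" and Z: "card Z = 2" and carrier: "carrier K = Z \<union> (\<Union>i\<in>I. B i)"
    and disj: "\<And>i. i \<in> I \<Longrightarrow> Z \<inter> B i = {}"
    and card_B: "\<And>i. i \<in> I \<Longrightarrow> 2 \<le> card (B i)"
    and central: "\<And>z x. z \<in> Z \<Longrightarrow> x \<in> carrier K \<Longrightarrow> z \<otimes>\<^bsub>K\<^esub> x = x \<otimes>\<^bsub>K\<^esub> z"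
    and inside: "\<And>i x y. i \<in> I \<Longrightarrow> x \<in> B i \<Longrightarrow> y \<in> B i \<Longrightarrow> x \<otimes>\<^bsub>K\<^esub> y = y \<otimes>\<^bsub>K\<^esub> x"
    and outside: "\<And>i j x y. i \<in> I \<Longrightarrow> j \<in> I \<Longrightarrow> i \<noteq> j \<Longrightarrow> x \<in> B i \<Longrightarrow> y \<in> B j \<Longrightarrow>
      x \<otimes>\<^bsub>K\<^esub> y \<noteq> y \<otimes>\<^bsub>K\<^esub> x"
    and j: "j1 \<in> I" "j2 \<in> I" "j3 \<in> I" "distinct [j1, j2, j3]"
    and m: "card (B j1) = m1" "card (B j2) = m2" "card (B j3) = m3" "m3 \<le> m2" "m2 \<le> m1"
    and max: "\<And>i. i \<in> I - {j1, j2} \<Longrightarrow> card (B i) \<le> m3"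
  shows "radius (commuting_graph K) = 1 \<and> diam (commuting_graph K) = 2 \<and>
    detour_radius (commuting_graph K) = enat (m1 + m2 + 1) \<and>
    detour_diam (commuting_graph K) = enat (m1 + m2 + m3 + 1) \<and>
    metric_dimension (commuting_graph K) = card (carrier K) - (card I + 1)"
proof -
  let ?P = "\<lparr>pverts = carrier K,
     parcs = {(x, y). x \<in> carrier K \<and> y \<in> carrier K \<and> x \<noteq> y \<and> x \<otimes>\<^bsub>K\<^esub> y = y \<otimes>\<^bsub>K\<^esub> x}\<rparr>"
  \<comment> \<open>A common element of two cliques would fail to commute with itself.\<close>
  have B: "B i \<inter> B j = {}" if "i \<in> I" "j \<in> I" "i \<noteq> j" for i j
    using outside[of i j] that by blast
  interpret three_largest_cliques ?P Z I B j1 j2 j3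
  proof unfold_locales
    show "disjoint_family_on B I" using B by (auto simp: disjoint_family_on_def)
    fix x y assume "x \<in> pverts ?P" "y \<in> pverts ?P"
    then have xy: "x \<in> carrier K" "y \<in> carrier K" by auto
    have "x \<otimes>\<^bsub>K\<^esub> y = y \<otimes>\<^bsub>K\<^esub> x \<longleftrightarrow> x \<in> Z \<or> y \<in> Z \<or> (\<exists>i\<in>I. x \<in> B i \<and> y \<in> B i)"
    proof
      assume *: "x \<otimes>\<^bsub>K\<^esub> y = y \<otimes>\<^bsub>K\<^esub> x"
      show "x \<in> Z \<or> y \<in> Z \<or> (\<exists>i\<in>I. x \<in> B i \<and> y \<in> B i)"
      proof (rule ccontr)
        assume "\<not> ?thesis"
        moreover from this obtain i j where "i \<in> I" "j \<in> I" "x \<in> B i" "y \<in> B j"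
          using xy unfolding carrier by blast
        ultimately show False using outside[of i j x y] * by blast
      qed
    next
      assume "x \<in> Z \<or> y \<in> Z \<or> (\<exists>i\<in>I. x \<in> B i \<and> y \<in> B i)"
      then show "x \<otimes>\<^bsub>K\<^esub> y = y \<otimes>\<^bsub>K\<^esub> x" using central xy inside by metis
    qed
    then show "(x, y) \<in> parcs ?P \<longleftrightarrow> x \<noteq> y \<and> (x \<in> Z \<or> y \<in> Z \<or> (\<exists>i\<in>I. x \<in> B i \<and> y \<in> B i))"
      using xy by simp
  qed (use assms in auto)
  have "card {j1, j2} \<le> card I" using j fin by (intro card_mono) auto
  then have "2 \<le> card I" using j by simp
  then show ?thesis
    unfolding commuting_graph_with_proj
    using radius diam[of j1 j2] detour_radius detour_diam metric_dimension j m by simp_all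
qed

section \<open>Actions of words, and evaluation of words in an isomorphic group\<close>

definition word_action :: "('g \<times> bool \<Rightarrow> 'x \<Rightarrow> 'x) \<Rightarrow> 'g word \<Rightarrow> 'x \<Rightarrow> 'x" where
  "word_action g u = foldr (\<circ>) (map g u) id"

lemma word_action_simps [simp]:
  "word_action g [] = id" "word_action g (l # u) = g l \<circ> word_action g u"
  by (auto simp: word_action_def)

lemma word_action_append: "word_action g (u @ v) = word_action g u \<circ> word_action g v"
  by (induction u) (auto simp: comp_assoc)

lemma word_action_replicate: "word_action g (replicate k l) = g l ^^ k"
  by (induction k) auto

text \<open>An action that respects the relations factors through the presented group. The use is
  contrapositive: words that act differently are not congruent.\<close>

lemma pres_cong_word_action:
  assumes "pres_cong R u v"
    and "\<And>x b. g (x, b) \<circ> g (x, \<not> b) = id"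
    and "\<And>u v. (u, v) \<in> R \<Longrightarrow> word_action g u = word_action g v"
  shows "word_action g u = word_action g v"
  using assms(1) by induction (auto simp: word_action_append assms(2,3))

text \<open>Replaces the isomorphism on classes by an evaluation \<open>e\<close> of words. The
  equivalence is read in both directions: relations become equations in the group, and an equation
  becomes a congruence that an action can refute.\<close>

lemma (in group) iso_presented_group:
  assumes "G \<cong> presented_group R"
  obtains e where "e [] = \<one>" "\<And>u v. e (u @ v) = e u \<otimes> e v" "\<And>u v. e u = e v \<longleftrightarrow> pres_cong R u v"
    "range e = carrier G"
proof -
  from assms have "presented_group R \<cong> G" by (rule iso_sym)
  then obtain f where f: "f \<in> iso (presented_group R) G" by (auto simp: is_iso_def)
  interpret P: group "presented_group R" by (rule group_presented_group)
  have hom: "f \<in> hom (presented_group R) G" and bij: "bij_betw f (carrier (presented_group R)) (carrier G)"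
    using f by (auto simp: iso_def)
  have c: "carrier (presented_group R) = range (pres_class R)"
    by (simp add: presented_group_def)
  show ?thesis
  proof (rule that[of "\<lambda>u. f (pres_class R u)"])
    have "f (\<one>\<^bsub>presented_group R\<^esub>) = \<one>" using hom_one[OF hom P.is_group is_group] .
    then show "f (pres_class R []) = \<one>" by (simp add: presented_group_def)
    show "f (pres_class R (u @ v)) = f (pres_class R u) \<otimes> f (pres_class R v)" for u v
      using hom_mult[OF hom, of "pres_class R u" "pres_class R v"] by (simp add: c presented_group_mult)
    show "f (pres_class R u) = f (pres_class R v) \<longleftrightarrow> pres_cong R u v" for u v
      using bij by (auto simp: bij_betw_def c inj_on_eq_iff simp flip: pres_class_eq_iff)
    show "range (\<lambda>u. f (pres_class R u)) = carrier G"
      using bij by (auto simp: bij_betw_def c)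
  qed
qed

lemma (in group) word_map_replicate:
  assumes "e [] = \<one>" "\<And>u v. e (u @ v) = e u \<otimes> e v" "range e \<subseteq> carrier G"
  shows "e (replicate k l) = e [l] [^] (k :: nat)"
proof (induction k)
  case (Suc k)
  have "e (replicate (Suc k) l) = e (replicate k l) \<otimes> e [l]"
    by (metis assms(2) replicate_Suc replicate_append_same)
  then show ?case using Suc assms(3) by simp
qed (use assms in simp)

lemma (in group) word_map_inverse:
  assumes "e [] = \<one>" "\<And>u v. e (u @ v) = e u \<otimes> e v" "range e \<subseteq> carrier G"
    and "\<And>u v. pres_cong R u v \<Longrightarrow> e u = e v"
  shows "e [(x, False)] = inv (e [(x, True)])"
proof -
  have "e [(x, False)] \<otimes> e [(x, True)] = \<one>"
    using assms(4)[OF pres_cong.cancel[of R x False]] assms(1) assms(2)[of "[(x, False)]" "[(x, True)]"] by simp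
  then show ?thesis using assms(3) by (intro inv_equality[symmetric]) auto
qed

section \<open>The binary dihedral groups\<close>

abbreviation dihedral_relations :: "nat \<Rightarrow> (dihedral_gen word \<times> dihedral_gen word) set" where
  "dihedral_relations n \<equiv> {(replicate (2 * n) (Gen_a, True), []), (replicate 4 (Gen_b, True), []),
     (replicate n (Gen_a, True), replicate 2 (Gen_b, True)),
     ([(Gen_a, True), (Gen_b, True)], [(Gen_b, True), (Gen_a, False)])}"

text \<open>The relations hold for the matrices \<open>diag(\<zeta>, \<zeta>\<^sup>-\<^sup>1)\<close> and \<open>((0, 1), (-1, 0))\<close> with \<open>\<zeta> = exp (\<pi>\<i> / n)\<close>.\<close>

lemma dihedral_relations_order:
  assumes "pres_cong (dihedral_relations n) (replicate k (Gen_a, True)) []" and n: "n \<noteq> 0"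
  shows "2 * n dvd k"
proof -
  define \<zeta> where "\<zeta> = cis (pi / n)"
  have "\<zeta> ^ n = cis (real n * (pi / n))" unfolding \<zeta>_def by (rule Complex.DeMoivre)
  then have \<zeta>: "\<zeta> \<noteq> 0" "\<zeta> ^ n = -1" using n by (simp_all add: \<zeta>_def)
  define g :: "dihedral_gen \<times> bool \<Rightarrow> complex \<times> complex \<Rightarrow> complex \<times> complex" where
    "g = (\<lambda>(x, b) (p, q). case x of
        Gen_a \<Rightarrow> if b then (\<zeta> * p, inverse \<zeta> * q) else (inverse \<zeta> * p, \<zeta> * q)
      | Gen_b \<Rightarrow> if b then (q, - p) else (- q, p))"
  have pow: "(g (Gen_a, True) ^^ j) = (\<lambda>(p, q). (\<zeta> ^ j * p, inverse \<zeta> ^ j * q))" for j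
    by (induction j) (auto simp: g_def fun_eq_iff)
  have "word_action g (replicate k (Gen_a, True)) = word_action g []"
  proof (rule pres_cong_word_action[OF assms(1)])
    show "g (x, b) \<circ> g (x, \<not> b) = id" for x b
      using \<zeta> by (cases x; cases b) (auto simp: g_def fun_eq_iff)
    fix u v assume "(u, v) \<in> dihedral_relations n"
    then show "word_action g u = word_action g v"
      using \<zeta>
      by (auto simp: word_action_replicate pow power_mult power_inverse mult.commute[of 2])
        (auto simp: fun_eq_iff g_def eval_nat_numeral)
  qed
  \<comment> \<open>The first coordinate of the image of (1, 0) is \<zeta>^k, and \<zeta> is a
    primitive root of unity of order 2n.\<close>
  then have "word_action g (replicate k (Gen_a, True)) (1, 0) = word_action g [] (1, 0)" by simp
  then have "\<zeta> ^ k = 1" by (simp add: word_action_replicate pow)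
  moreover have "\<zeta> = exp (2 * of_real pi * \<i> / of_nat (2 * n))"
    by (simp add: \<zeta>_def cis_conv_exp field_simps)
  ultimately have "exp (2 * of_real pi * \<i> * of_nat k / of_nat (2 * n)) = 1"
    by (simp add: exp_of_nat_mult[symmetric] field_simps)
  then show ?thesis
    using complex_root_unity_eq_1[of "2 * n" k] n by simp
qed

text \<open>The relations only show that \<open>ord a\<close> divides 2n; the converse divisibility
  comes from the action by roots of unity.\<close>

lemma (in group) binary_dihedral_generators:
  assumes iso: "G \<cong> binary_dihedral n" and n: "2 \<le> n"
  obtains a b where "a \<in> carrier G" "b \<in> carrier G" "ord a = 2 * n" "b \<otimes> b = a [^] n"
    "b \<otimes> a = inv a \<otimes> b" "carrier G = {a [^] i | i. i < 2 * n} \<union> {a [^] i \<otimes> b | i. i < 2 * n}"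
proof -
  let ?R = "dihedral_relations n"
  from iso have "G \<cong> presented_group ?R" by (simp add: binary_dihedral_def Let_def)
  then obtain e where e: "e [] = \<one>" "\<And>u v. e (u @ v) = e u \<otimes> e v" "\<And>u v. e u = e v \<longleftrightarrow> pres_cong ?R u v"
    "range e = carrier G" by (rule iso_presented_group) blast
  define a where "a = e [(Gen_a, True)]"
  define b where "b = e [(Gen_b, True)]"
  have ab [simp]: "a \<in> carrier G" "b \<in> carrier G" using e(4) by (auto simp: a_def b_def)
  note rep = word_map_replicate[OF e(1,2) equalityD1[OF e(4)]]
  have rel: "e u = e v" if "(u, v) \<in> ?R" for u v
    unfolding e(3) using that by (rule pres_cong.rel)
  have inv: "e [(x, False)] = inv (e [(x, True)])" for x
    by (rule word_map_inverse[OF e(1,2) equalityD1[OF e(4)], where R = ?R]) (simp only: e(3))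
  have a2n: "a [^] (2 * n) = \<one>"
    using rel[of "replicate (2 * n) (Gen_a, True)" "[]"] by (simp add: rep e(1) a_def)
  have "a [^] n = b [^] (2::nat)"
    using rel[of "replicate n (Gen_a, True)" "replicate 2 (Gen_b, True)"]
    unfolding rep a_def b_def by simp
  then have bb: "b \<otimes> b = a [^] n" by (simp add: numeral_2_eq_2)
  have "e ([(Gen_a, True)] @ [(Gen_b, True)]) = e ([(Gen_b, True)] @ [(Gen_a, False)])"
    using rel[of "[(Gen_a, True), (Gen_b, True)]" "[(Gen_b, True), (Gen_a, False)]"] by simp
  then have "a \<otimes> b = b \<otimes> inv a" unfolding e(2) by (simp add: inv a_def b_def)
  then have "a \<otimes> (b \<otimes> a) = b" by (simp add: m_assoc[symmetric]) (simp add: m_assoc)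
  then have ba: "b \<otimes> a = inv a \<otimes> b" by (metis ab inv_solve_left m_closed)
  have "2 * n dvd ord a"
  proof -
    have "e (replicate (ord a) (Gen_a, True)) = e []" by (simp add: rep e(1) flip: a_def)
    then show ?thesis
      using dihedral_relations_order[of n "ord a"] n
      unfolding e(3) by simp
  qed
  moreover have "ord a dvd 2 * n" using a2n pow_eq_id by simp
  ultimately have ord: "ord a = 2 * n" by (rule dvd_antisym[rotated])
  \<comment> \<open>Normal forms with arbitrary exponents. Since \<open>b\<close> inverts
    \<open>a\<close> under conjugation, and the inverses of \<open>a\<close> and \<open>b\<close>
    are products of generators, \<open>S\<close> absorbs every letter from the left and so contains
    the value of every word.\<close>
  define S where "S = {a [^] i | i::nat. True} \<union> {a [^] i \<otimes> b | i::nat. True}"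
  have inva: "inv a = a [^] (2 * n - 1)"
  proof (rule inv_equality)
    have "a [^] (2 * n - 1) \<otimes> a = a [^] Suc (2 * n - 1)" by simp
    also have "\<dots> = \<one>" using n a2n by simp
    finally show "a [^] (2 * n - 1) \<otimes> a = \<one>" .
  qed auto
  have S_a: "a [^] (k::nat) \<otimes> x \<in> S" if "x \<in> S" for x k
    using that by (auto simp: S_def nat_pow_mult m_assoc[symmetric])
  have ba_pow: "b \<otimes> a [^] i = inv a [^] i \<otimes> b" for i :: nat
  proof (induction i)
    case (Suc i)
    have "b \<otimes> a [^] Suc i = (b \<otimes> a [^] i) \<otimes> a" by (simp add: m_assoc)
    also have "\<dots> = inv a [^] i \<otimes> (b \<otimes> a)" by (simp add: Suc m_assoc)
    finally show ?case by (simp add: ba m_assoc)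
  qed simp
  have S_b: "b \<otimes> x \<in> S" if "x \<in> S" for x
  proof -
    have "b \<otimes> a [^] i = a [^] ((2 * n - 1) * i) \<otimes> b" for i
      by (simp add: ba_pow inva nat_pow_pow)
    moreover have "b \<otimes> (a [^] i \<otimes> b) = a [^] ((2 * n - 1) * i + n)" for i
      by (simp add: m_assoc[symmetric] ba_pow inva nat_pow_pow)
        (simp add: m_assoc bb nat_pow_mult)
    ultimately show ?thesis using that by (auto simp: S_def)
  qed
  have invb: "inv b = a [^] n \<otimes> b"
  proof (rule inv_equality)
    have "(a [^] n \<otimes> b) \<otimes> b = a [^] n \<otimes> a [^] n" by (simp add: m_assoc bb)
    then show "(a [^] n \<otimes> b) \<otimes> b = \<one>" using a2n by (simp add: nat_pow_mult mult_2)
  qed auto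
  have "e w \<in> S" for w
  proof (induction w)
    case Nil
    have "\<one> = a [^] (0::nat)" by simp
    then show ?case unfolding e(1) S_def by blast
  next
    case (Cons l w)
    obtain x c where l: "l = (x, c)" by (cases l)
    have "e (l # w) = e [l] \<otimes> e w" using e(2)[of "[l]" w] by simp
    moreover have "e [l] = a \<or> e [l] = a [^] (2 * n - 1) \<or> e [l] = b \<or> e [l] = a [^] n \<otimes> b"
      using inv inva invb by (cases x; cases c) (auto simp: l simp flip: a_def b_def)
    moreover have "e w \<in> carrier G" using e(4) by auto
    ultimately show ?case
      using S_a[OF Cons, of 1] S_a[OF Cons] S_b[OF Cons] S_a[OF S_b[OF Cons]] by (auto simp: m_assoc)
  qed
  then have "carrier G \<subseteq> S" unfolding e(4)[symmetric] by auto
  have mod: "a [^] i = a [^] (i mod (2 * n))" for i :: nat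
  proof -
    have "a [^] i = a [^] ((2 * n) * (i div (2 * n)) + i mod (2 * n))" by simp
    also have "\<dots> = (a [^] (2 * n)) [^] (i div (2 * n)) \<otimes> a [^] (i mod (2 * n))"
      by (simp only: nat_pow_mult[symmetric] nat_pow_pow ab)
    finally show ?thesis by (simp add: a2n)
  qed
  have lt: "i mod (2 * n) < 2 * n" for i using n by simp
  have "carrier G \<subseteq> {a [^] i | i. i < 2 * n} \<union> {a [^] i \<otimes> b | i. i < 2 * n}"
  proof
    fix x assume "x \<in> carrier G"
    then obtain i :: nat where "x = a [^] i \<or> x = a [^] i \<otimes> b"
      using \<open>carrier G \<subseteq> S\<close> unfolding S_def by blast
    then show "x \<in> {a [^] i | i. i < 2 * n} \<union> {a [^] i \<otimes> b | i. i < 2 * n}"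
      using mod[of i] lt[of i] by auto
  qed
  then have "carrier G = {a [^] i | i. i < 2 * n} \<union> {a [^] i \<otimes> b | i. i < 2 * n}" by auto
  then show ?thesis using that[OF ab ord bb ba] by simp
qed

lemma (in group) commuting_graph_binary_dihedral:
  assumes iso: "G \<cong> binary_dihedral n" and n: "2 \<le> n"
  shows "radius (commuting_graph G) = 1" "diam (commuting_graph G) = 2"
    "detour_radius (commuting_graph G) = enat (2 * n + 1)"
    "detour_diam (commuting_graph G) = enat (2 * n + 3)"
    "metric_dimension (commuting_graph G) = 3 * n - 2"
proof -
  obtain a b where ab [simp]: "a \<in> carrier G" "b \<in> carrier G" and ord: "ord a = 2 * n"
    and bb: "b \<otimes> b = a [^] n" and ba: "b \<otimes> a = inv a \<otimes> b"
    and carrier: "carrier G = {a [^] i | i. i < 2 * n} \<union> {a [^] i \<otimes> b | i. i < 2 * n}"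
    using binary_dihedral_generators[OF assms] by blast
  have pow_eq: "a [^] i = a [^] j \<longleftrightarrow> i = j" if "i < 2 * n" "j < 2 * n" for i j
    using inj_onD[OF ord_inj[OF ab(1)], of i j] that ord by auto
  have ba_pow: "b \<otimes> a [^] i = inv a [^] i \<otimes> b" for i :: nat
  proof (induction i)
    case (Suc i)
    have "b \<otimes> a [^] Suc i = (b \<otimes> a [^] i) \<otimes> a" by (simp add: m_assoc)
    also have "\<dots> = inv a [^] i \<otimes> (b \<otimes> a)" by (simp add: Suc m_assoc)
    finally show ?case by (simp add: ba m_assoc)
  qed simp
  \<comment> \<open>Conjugation by \<open>b\<close> inverts \<open>a\<close>, so commuting means
    that the power 2i of \<open>a\<close> is 1, and \<open>a\<close> has order 2n.\<close>
  have commute_b: "a [^] i \<otimes> b = b \<otimes> a [^] i \<longleftrightarrow> n dvd i" for i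
  proof -
    have "a [^] i \<otimes> b = b \<otimes> a [^] i \<longleftrightarrow> a [^] i = inv (a [^] i)"
      by (simp add: ba_pow nat_pow_inv)
    also have "\<dots> \<longleftrightarrow> a [^] i \<otimes> a [^] i = \<one>"
      by (metis ab(1) inv_equality nat_pow_closed r_inv)
    also have "\<dots> \<longleftrightarrow> n dvd i"
      using pow_eq_id[OF ab(1), of "i + i"] by (simp add: nat_pow_mult ord mult_2[symmetric])
    finally show ?thesis .
  qed
  \<comment> \<open>Otherwise \<open>b\<close> would commute with \<open>a\<close>, against
    \<open>commute_b\<close> for exponent 1 and n \<ge> 2.\<close>
  have neq: "a [^] i \<otimes> b \<noteq> a [^] j" for i j :: nat
  proof
    assume "a [^] i \<otimes> b = a [^] j"
    then have "a [^] i \<otimes> (a \<otimes> b) = a [^] i \<otimes> (b \<otimes> a)"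
      by (metis ab group_commutes_pow m_assoc nat_pow_closed)
    then have "a [^] (1::nat) \<otimes> b = b \<otimes> a [^] (1::nat)" by simp
    then have "n dvd 1" using commute_b[of 1] by simp
    then show False using n by simp
  qed
  have b_eq: "a [^] i \<otimes> b = a [^] j \<otimes> b \<longleftrightarrow> i = j" if "i < 2 * n" "j < 2 * n" for i j
    using pow_eq[OF that] by simp
  have pow_comm: "a [^] i \<otimes> a [^] j = a [^] j \<otimes> a [^] i" for i j :: nat
    by (simp add: nat_pow_mult add.commute)
  have mixed: "a [^] i \<otimes> (a [^] j \<otimes> b) = (a [^] j \<otimes> b) \<otimes> a [^] i \<longleftrightarrow> n dvd i" for i j :: nat
  proof -
    have "a [^] i \<otimes> (a [^] j \<otimes> b) = a [^] j \<otimes> (a [^] i \<otimes> b)"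
      by (simp add: m_assoc[symmetric] pow_comm)
    then show ?thesis by (simp add: m_assoc commute_b)
  qed
  have both: "(a [^] i \<otimes> b) \<otimes> (a [^] j \<otimes> b) = (a [^] j \<otimes> b) \<otimes> (a [^] i \<otimes> b) \<longleftrightarrow> n dvd j - i"
    if "i \<le> j" for i j :: nat
  proof -
    have "a [^] j \<otimes> b = a [^] (j - i) \<otimes> (a [^] i \<otimes> b)"
      using that by (simp add: m_assoc[symmetric] nat_pow_mult)
    then have "(a [^] i \<otimes> b) \<otimes> (a [^] j \<otimes> b) = (a [^] j \<otimes> b) \<otimes> (a [^] i \<otimes> b) \<longleftrightarrow>
      (a [^] i \<otimes> b) \<otimes> a [^] (j - i) = a [^] (j - i) \<otimes> (a [^] i \<otimes> b)"
      by (simp add: m_assoc[symmetric])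
    then show ?thesis using mixed[of "j - i" i] by metis
  qed
  define Z where "Z = {a [^] (0::nat), a [^] n}"
  \<comment> \<open>Clique 0 consists of the noncentral powers of \<open>a\<close>. Two elements
    \<open>a [^] i \<otimes> b\<close> commute exactly when their exponents agree modulo n, so these
    elements fall into n pairs; in total there are n + 1 cliques.\<close>
  define B where "B = (\<lambda>j. case j of 0 \<Rightarrow> (\<lambda>i. a [^] i) ` ({..<2 * n} - {0, n})
    | Suc j \<Rightarrow> {a [^] j \<otimes> b, a [^] (j + n) \<otimes> b})"
  have "card (B 0) = card ({..<2 * n} - {0, n})"
    unfolding B_def by (simp, intro card_image inj_onI) (simp add: pow_eq)
  then have card_0: "card (B 0) = 2 * n - 2" using n by (simp add: card_Diff_subset)
  have card_Suc: "card (B (Suc j)) = 2" if "j < n" for j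
    using that b_eq[of j "j + n"] n by (simp add: B_def)
  have carr: "carrier G = Z \<union> (\<Union>i\<in>{..n}. B i)"
  proof
    show "carrier G \<subseteq> Z \<union> (\<Union>i\<in>{..n}. B i)"
    proof
      fix x assume "x \<in> carrier G"
      then consider i where "i < 2 * n" "x = a [^] i" | i where "i < 2 * n" "x = a [^] i \<otimes> b"
        by (auto simp: carrier)
      then show "x \<in> Z \<union> (\<Union>i\<in>{..n}. B i)"
      proof cases
        case 1
        then have "x \<in> Z \<union> B 0" by (auto simp: Z_def B_def)
        then show ?thesis by blast
      next
        case 2
        have "x \<in> B (Suc (if i < n then i else i - n))" using 2 by (auto simp: B_def)
        moreover have "Suc (if i < n then i else i - n) \<in> {..n}" using 2 by auto
        ultimately show ?thesis by blast
      qed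
    qed
    show "Z \<union> (\<Union>i\<in>{..n}. B i) \<subseteq> carrier G"
      by (auto simp: Z_def B_def split: nat.splits)
  qed
  have Z: "card Z = 2" using pow_eq[of 0 n] n by (simp add: Z_def)
  have "card (carrier G) = 4 * n"
  proof -
    have "carrier G = (\<lambda>i. a [^] i) ` {..<2 * n} \<union> (\<lambda>i. a [^] i \<otimes> b) ` {..<2 * n}"
      unfolding carrier by auto
    moreover have "card ((\<lambda>i. a [^] i) ` {..<2 * n}) = 2 * n" "card ((\<lambda>i. a [^] i \<otimes> b) ` {..<2 * n}) = 2 * n"
      by (subst card_image; auto intro!: inj_onI simp: pow_eq b_eq)+
    moreover have "(\<lambda>i. a [^] i) ` {..<2 * n} \<inter> (\<lambda>i. a [^] i \<otimes> b) ` {..<2 * n} = {}"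
      using neq by auto metis
    ultimately show ?thesis by (simp add: card_Un_disjoint)
  qed
  have disj: "Z \<inter> B i = {}" if "i \<in> {..n}" for i
  proof (cases i)
    case 0
    then show ?thesis using pow_eq[of 0] pow_eq[of n] n by (auto simp: Z_def B_def simp del: nat_pow_0)
  next
    case (Suc j)
    then show ?thesis using neq[of j 0] neq[of "j + n" 0] neq[of j n] neq[of "j + n" n] by (auto simp: Z_def B_def dest: sym)
  qed
  have card_B: "2 \<le> card (B i)" if "i \<in> {..n}" for i
    using that card_0 card_Suc[of "i - 1"] n by (cases i) auto
  have central: "z \<otimes> x = x \<otimes> z" if "z \<in> Z" "x \<in> carrier G" for z x
    using that mixed[of 0] mixed[of n] pow_comm[of 0] by (auto simp: Z_def carrier pow_comm simp del: nat_pow_0)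
  have inside: "x \<otimes> y = y \<otimes> x" if "i \<in> {..n}" "x \<in> B i" "y \<in> B i" for i x y
    using that both[of "i - 1" "i - 1 + n"] by (cases i) (auto simp: B_def pow_comm)
  have outside: "x \<otimes> y \<noteq> y \<otimes> x" if ij: "i \<in> {..n}" "j \<in> {..n}" "i < j" "x \<in> B i" "y \<in> B j" for i j x y
  proof -
    from ij obtain l where l: "j = Suc l" "l < n" by (cases j) auto
    obtain k where k: "y = a [^] k \<otimes> b" "k = l \<or> k = l + n" using ij l by (auto simp: B_def)
    show ?thesis
    proof (cases i)
      case 0
      then obtain m where m: "m < 2 * n" "m \<noteq> 0" "m \<noteq> n" "x = a [^] m" using ij by (auto simp: B_def)
      have "\<not> n dvd m"
      proof
        assume "n dvd m"
        then obtain c where "m = n * c" by blast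
        moreover from this have "c < 2" using \<open>m < 2 * n\<close> n by simp
        ultimately show False using \<open>m \<noteq> 0\<close> \<open>m \<noteq> n\<close> by (auto simp: less_2_cases_iff)
      qed
      then show ?thesis using m mixed k by simp
    next
      case (Suc l')
      then obtain m where m: "x = a [^] m \<otimes> b" "m = l' \<or> m = l' + n" using ij by (auto simp: B_def)
      have "l' < l" using Suc l ij by simp
      show ?thesis
      proof (cases "m \<le> k")
        case True
        \<comment> \<open>Exponents from different pairs are not congruent modulo n.\<close>
        then have "k - m = l - l' \<or> k - m = (l - l') + n" using k m \<open>l' < l\<close> l by auto
        moreover have "\<not> n dvd l - l'" using \<open>l' < l\<close> l by (auto dest!: dvd_imp_le)
          ultimately have "\<not> n dvd k - m" by (metis dvd_add_triv_right_iff)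
        then show ?thesis using both[OF True] k m by simp
      next
        case False
        then have "m - k = n - (l - l')" using k m \<open>l' < l\<close> l by auto
        then have "\<not> n dvd m - k" using \<open>l' < l\<close> l by (auto dest!: dvd_imp_le)
        then show ?thesis using both[of k m] False k m by auto
      qed
    qed
  qed
  have outside': "x \<otimes> y \<noteq> y \<otimes> x" if "i \<in> {..n}" "j \<in> {..n}" "i \<noteq> j" "x \<in> B i" "y \<in> B j" for i j x y
    using outside[of i j x y] outside[of j i y x] that by (cases "i < j") auto
  have "card (B 1) = 2" "card (B 2) = 2" using card_Suc[of 0] card_Suc[of 1] n by (simp_all add: numeral_2_eq_2)
  moreover have "card (B i) \<le> 2" if "i \<in> {..n} - {0, 1}" for i
    using that card_Suc[of "i - 1"] by (cases i) auto
  ultimately have "radius (commuting_graph G) = 1 \<and> diam (commuting_graph G) = 2 \<and>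
    detour_radius (commuting_graph G) = enat (2 * n - 2 + 2 + 1) \<and>
    detour_diam (commuting_graph G) = enat (2 * n - 2 + 2 + 2 + 1) \<and>
    metric_dimension (commuting_graph G) = card (carrier G) - (card {..n} + 1)"
  proof (intro commuting_graph_cliques[where Z = Z and I = "{..n}" and B = B
        and ?j1.0 = 0 and ?j2.0 = 1 and ?j3.0 = 2])
    show "z \<otimes> x = x \<otimes> z" if "z \<in> Z" "x \<in> carrier G" for z x by (rule central[OF that])
  qed (use n Z carr disj card_B inside outside' card_0 in auto)
  then show "radius (commuting_graph G) = 1" "diam (commuting_graph G) = 2"
    "detour_radius (commuting_graph G) = enat (2 * n + 1)"
    "detour_diam (commuting_graph G) = enat (2 * n + 3)"
    "metric_dimension (commuting_graph G) = 3 * n - 2"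
    using n \<open>card (carrier G) = 4 * n\<close> by (simp_all del: One_nat_def)
qed

section \<open>Matrices of size two\<close>

definition scale_mat :: "complex \<Rightarrow> complex^2^2 \<Rightarrow> complex^2^2" where
  "scale_mat c A = (\<chi> i j. c * A $ i $ j)"

definition scalar_mat :: "complex^2^2 \<Rightarrow> bool" where
  "scalar_mat A \<longleftrightarrow> A $ 1 $ 2 = 0 \<and> A $ 2 $ 1 = 0 \<and> A $ 1 $ 1 = A $ 2 $ 2"

lemma scale_mat_nth [simp]: "scale_mat c A $ i $ j = c * A $ i $ j"
  by (simp add: scale_mat_def)

lemma mat2_eq_iff:
  fixes A B :: "'a^2^2"
  shows "A = B \<longleftrightarrow> A $ 1 $ 1 = B $ 1 $ 1 \<and> A $ 1 $ 2 = B $ 1 $ 2 \<and> A $ 2 $ 1 = B $ 2 $ 1 \<and> A $ 2 $ 2 = B $ 2 $ 2"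
  by (simp add: vec_eq_iff forall_2)

lemma mat2_mult_nth:
  fixes A B :: "'a::semiring_1^2^2"
  shows "(A ** B) $ i $ j = A $ i $ 1 * B $ 1 $ j + A $ i $ 2 * B $ 2 $ j"
  by (simp add: matrix_matrix_mult_def sum_2)

lemma mat2_one_nth:
  "(mat 1 :: 'a::semiring_1^2^2) $ 1 $ 1 = 1" "(mat 1 :: 'a^2^2) $ 1 $ 2 = 0"
  "(mat 1 :: 'a^2^2) $ 2 $ 1 = 0" "(mat 1 :: 'a^2^2) $ 2 $ 2 = 1"
  by (simp_all add: mat_def)

lemma trace_2: "trace (A :: 'a::comm_semiring_1^2^2) = A $ 1 $ 1 + A $ 2 $ 2"
  by (simp add: trace_def sum_2)

lemmas mat2_simps = mat2_eq_iff mat2_mult_nth mat2_one_nth trace_2 det_2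

lemma scale_mat_mult [simp]:
  "scale_mat a A ** B = scale_mat a (A ** B)" "A ** scale_mat a B = scale_mat a (A ** B)"
  by (simp_all add: mat2_simps algebra_simps)

lemma uminus_mat_mult [simp]:
  fixes A B :: "complex^2^2"
  shows "(- A) ** B = - (A ** B)" "A ** (- B) = - (A ** B)"
  by (simp_all add: mat2_simps algebra_simps)

lemma mat2_distrib:
  fixes A B C :: "complex^2^2"
  shows "(A + B) ** C = A ** C + B ** C" "(A - B) ** C = A ** C - B ** C"
    "C ** (A + B) = C ** A + C ** B" "C ** (A - B) = C ** A - C ** B"
  by (simp_all add: mat2_simps algebra_simps)

text \<open>The coordinates of A modulo scalars are A12, A21 and A11 - A22. The three equations say
  that the cross product of the two coordinate vectors vanishes, so commuting is parallelism in a
  space of dimension three.\<close>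

lemma mat2_commute_iff:
  fixes A B :: "complex^2^2"
  shows "A ** B = B ** A \<longleftrightarrow> A $ 1 $ 2 * B $ 2 $ 1 = B $ 1 $ 2 * A $ 2 $ 1 \<and>
    A $ 1 $ 2 * (B $ 1 $ 1 - B $ 2 $ 2) = B $ 1 $ 2 * (A $ 1 $ 1 - A $ 2 $ 2) \<and>
    A $ 2 $ 1 * (B $ 1 $ 1 - B $ 2 $ 2) = B $ 2 $ 1 * (A $ 1 $ 1 - A $ 2 $ 2)"
  unfolding mat2_simps by (auto simp: algebra_simps)

text \<open>Vectors parallel to a fixed nonzero vector are parallel to each other. By symmetry there
  are two patterns: \<open>e\<close> for a minor that involves the nonzero coordinate,
  \<open>f\<close> for the minor that does not.\<close>

lemma parallel_trans:
  fixes a1 :: complex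
  assumes "a1 \<noteq> 0 \<or> a2 \<noteq> 0 \<or> a3 \<noteq> 0"
    and "a1 * b2 = b1 * a2" "a1 * b3 = b1 * a3" "a2 * b3 = b2 * a3"
    and "a1 * c2 = c1 * a2" "a1 * c3 = c1 * a3" "a2 * c3 = c2 * a3"
  shows "b1 * c2 = c1 * b2" "b1 * c3 = c1 * b3" "b2 * c3 = c2 * b3"
proof -
  have e: "b1 * c2 = c1 * b2" if "a1 \<noteq> 0" "a1 * b2 = b1 * a2" "a1 * c2 = c1 * a2" for a1 a2 b1 b2 c1 c2 :: complex
  proof -
    have "a1 * (b1 * c2) = a1 * (c1 * b2)" using that by Groebner_Basis.algebra
    then show ?thesis using that by simp
  qed
  have f: "b2 * c3 = c2 * b3" if "a1 \<noteq> 0" "a1 * b2 = b1 * a2" "a1 * b3 = b1 * a3"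
     "a1 * c2 = c1 * a2" "a1 * c3 = c1 * a3" for a1 a2 a3 b1 b2 b3 c1 c2 c3 :: complex
  proof -
    \<comment> \<open>Both sides equal \<open>b1 * c1 * a2 * a3\<close>.\<close>
    have "a1 * a1 * (b2 * c3) = a1 * a1 * (c2 * b3)" using that(2-) by Groebner_Basis.algebra
    then show ?thesis using that by simp
  qed
  from assms(1) consider "a1 \<noteq> 0" | "a2 \<noteq> 0" | "a3 \<noteq> 0" by blast
  then have "b1 * c2 = c1 * b2 \<and> b1 * c3 = c1 * b3 \<and> b2 * c3 = c2 * b3"
  proof cases
    case 1
    then show ?thesis
      using e[of a1 b2 b1 a2 c2 c1] e[of a1 b3 b1 a3 c3 c1] f[of a1 b2 b1 a2 b3 a3 c2 c1 c3] assms by metis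
  next
    case 2
    then show ?thesis
      using e[of a2 b1 b2 a1 c1 c2] e[of a2 b3 b2 a3 c3 c2] f[of a2 b1 b2 a1 b3 a3 c1 c2 c3] assms
      by (metis mult.commute)
  next
    case 3
    then show ?thesis
      using e[of a3 b1 b3 a1 c1 c3] e[of a3 b2 b3 a2 c2 c3] f[of a3 b1 b3 a1 b2 a2 c1 c3 c2] assms
      by (metis mult.commute)
  qed
  then show "b1 * c2 = c1 * b2" "b1 * c3 = c1 * b3" "b2 * c3 = c2 * b3" by auto
qed

lemma commute_trans:
  fixes A B C :: "complex^2^2"
  assumes "\<not> scalar_mat A" "A ** B = B ** A" "A ** C = C ** A"
  shows "B ** C = C ** B"
  using assms parallel_trans[of "A $ 1 $ 2" "A $ 2 $ 1" "A $ 1 $ 1 - A $ 2 $ 2"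
      "B $ 2 $ 1" "B $ 1 $ 2" "B $ 1 $ 1 - B $ 2 $ 2" "C $ 2 $ 1" "C $ 1 $ 2" "C $ 1 $ 1 - C $ 2 $ 2"]
  unfolding mat2_commute_iff scalar_mat_def by auto

lemma scalar_mat_commute: "scalar_mat A \<Longrightarrow> A ** B = B ** A"
  unfolding mat2_commute_iff scalar_mat_def by auto

lemma scalar_mat_det_one:
  assumes "scalar_mat A" "det A = 1"
  shows "A = mat 1 \<or> A = - mat 1"
proof -
  have "A $ 1 $ 1 * A $ 1 $ 1 = 1" using assms by (simp add: det_2 scalar_mat_def)
  then have "A $ 1 $ 1 = 1 \<or> A $ 1 $ 1 = -1" by (metis square_eq_1_iff)
  then show ?thesis using assms by (auto simp: mat2_simps scalar_mat_def)
qed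

section \<open>Powers of a matrix of determinant one, and its trace\<close>

lemma cayley_hamilton_det_one:
  assumes "det A = 1"
  shows "A ** A = scale_mat (trace A) A - mat 1"
  using assms unfolding mat2_simps by (auto simp: mat2_simps algebra_simps)

lemma scale_mat_independent:
  assumes "\<not> scalar_mat A" "scale_mat a A + scale_mat b (mat 1) = scale_mat c (mat 1)"
  shows "a = 0" "b = c"
  using assms by (auto simp: mat2_simps scalar_mat_def)

text \<open>The coefficients of A and 1 in the k-th power of A when A has determinant 1 and trace c,
  by iterating the Cayley-Hamilton relation. They are Chebyshev polynomials of the second kind at
  c/2: the pair is U_(k-1), - U_(k-2).\<close>

definition power_coeffs :: "complex \<Rightarrow> nat \<Rightarrow> complex \<times> complex" where
  "power_coeffs c k = ((\<lambda>(a, b). (c * a + b, - a)) ^^ k) (0, 1)"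

lemma mat_power_det_one:
  assumes "det A = 1"
  shows "((\<lambda>X. X ** A) ^^ k) (mat 1) =
    scale_mat (fst (power_coeffs (trace A) k)) A + scale_mat (snd (power_coeffs (trace A) k)) (mat 1)"
proof (induction k)
  case 0
  then show ?case by (simp add: power_coeffs_def mat2_simps)
next
  case (Suc k)
  have "(scale_mat a A + scale_mat b (mat 1)) ** A =
      scale_mat (trace A * a + b) A + scale_mat (- a) (mat 1)" for a b
    by (simp add: mat2_distrib cayley_hamilton_det_one[OF assms])
      (simp add: mat2_simps algebra_simps)
  then show ?case using Suc by (simp add: power_coeffs_def split_beta)
qed

text \<open>As 1 and a nonscalar matrix are linearly independent, a relation that makes a power
  scalar turns into polynomial equations for the trace.\<close>

lemma mat_power_eq_scalar:
  assumes "det A = 1" "\<not> scalar_mat A" "((\<lambda>X. X ** A) ^^ k) (mat 1) = scale_mat c (mat 1)"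
  shows "power_coeffs (trace A) k = (0, c)"
  using scale_mat_independent[OF assms(2)] mat_power_det_one[OF assms(1), of k] assms(3)
  by (metis prod.collapse)

section \<open>The basis 1, s, t, st of the matrices\<close>

locale quaternion_basis =
  fixes s t :: "complex^2^2" and \<tau> :: complex
  assumes det_s: "det s = 1" and det_t: "det t = 1"
    and trace_s: "trace s = 1" and trace_t: "trace t = \<tau>" and trace_st: "trace (s ** t) = 0"
    and tau: "\<tau>\<^sup>2 \<noteq> 3"
begin

definition comb :: "complex \<Rightarrow> complex \<Rightarrow> complex \<Rightarrow> complex \<Rightarrow> complex^2^2" where
  "comb a b c d = scale_mat a (mat 1) + scale_mat b s + scale_mat c t + scale_mat d (s ** t)"

lemma mult_ss: "s ** s = s - mat 1"
  using cayley_hamilton_det_one[OF det_s] trace_s by (simp add: mat2_simps)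

lemma mult_tt: "t ** t = scale_mat \<tau> t - mat 1"
  using cayley_hamilton_det_one[OF det_t] trace_t by simp

text \<open>The polarized Cayley-Hamilton identity st + ts = tr(s) t + tr(t) s + (tr(st) - tr(s)
  tr(t)), for tr(s) = 1, tr(t) = \<tau> and tr(st) = 0.\<close>

lemma mult_ts: "t ** s = t + scale_mat \<tau> s - scale_mat \<tau> (mat 1) - s ** t"
proof -
  have alg: "p * a + q * c = p + \<tau> * a - \<tau> - (a * p + b * r)"
    "p * b + q * d = q + \<tau> * b - (a * q + b * u)"
    "r * a + u * c = r + \<tau> * c - (c * p + d * r)"
    "r * b + u * d = u + \<tau> * d - \<tau> - (c * q + d * u)"
    if "a + d = 1" "p + u = \<tau>" "a * p + b * r + (c * q + d * u) = 0" for a b c d p q r u :: complex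
    using that by Groebner_Basis.algebra+
  show ?thesis
    unfolding mat2_eq_iff
    using alg[of "s $ 1 $ 1" "s $ 2 $ 2" "t $ 1 $ 1" "t $ 2 $ 2" "s $ 1 $ 2" "t $ 2 $ 1" "s $ 2 $ 1" "t $ 1 $ 2"]
      trace_s trace_t trace_st
    by (simp add: mat2_mult_nth mat2_one_nth trace_2)
qed

lemma comb_mult_t: "comb a b c d ** t = comb (- c) (- d) (a + \<tau> * c) (b + \<tau> * d)"
proof -
  have "s ** t ** t = scale_mat \<tau> (s ** t) - s"
    by (simp add: matrix_mul_assoc[symmetric] mult_tt)
      (simp add: mat2_simps algebra_simps)
  then show ?thesis
    unfolding comb_def by (simp add: mat2_distrib mult_tt) (simp add: mat2_eq_iff algebra_simps)
qed

text \<open>The one product that is not given directly by \<open>mult_ss\<close> and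
  \<open>mult_ts\<close> is sts = t - \<tau>, which amounts to (st)^2 = -1.\<close>

lemma comb_mult_s:
  "comb a b c d ** s = comb (- (b + \<tau> * (c + d))) (a + b + \<tau> * c) (c + d) (- c)"
proof -
  have "s ** t ** s = s ** t + scale_mat \<tau> (s ** s) - scale_mat \<tau> s - (s ** s) ** t"
    by (simp add: matrix_mul_assoc[symmetric] mult_ts) (simp add: mat2_simps algebra_simps)
  also have "\<dots> = t - scale_mat \<tau> (mat 1)"
    unfolding mult_ss by (simp add: mat2_eq_iff mat2_mult_nth mat2_one_nth algebra_simps)
  finally show ?thesis
    unfolding comb_def by (simp add: mat2_distrib mult_ss mult_ts) (simp add: mat2_eq_iff algebra_simps)
qed

lemma trace_comb: "trace (comb a b c d) = 2 * a + b + \<tau> * c"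
proof -
  have "trace (scale_mat x A) = x * trace A" for x A by (simp add: trace_2 algebra_simps)
  moreover have "trace (mat 1 :: complex^2^2) = 2" by (simp add: trace_2 mat2_one_nth)
  ultimately show ?thesis by (simp add: comb_def trace_add trace_s trace_t trace_st)
qed

text \<open>The Gram determinant of \<open>1, s, t, st\<close> for the form \<open>trace (xy)\<close> is \<open>- (\<tau>\<^sup>2 - 3)\<^sup>2\<close>.\<close>

lemma comb_eq_0:
  assumes "comb a b c d = 0"
  shows "a = 0 \<and> b = 0 \<and> c = 0 \<and> d = 0"
proof -
  have z: "trace (comb a b c d) = 0" "trace (comb a b c d ** s) = 0" "trace (comb a b c d ** t) = 0"
    "trace (comb a b c d ** s ** t) = 0"
    by (simp_all add: assms mat2_mult_nth trace_2)
  have e1: "2 * a + b + \<tau> * c = 0" using z(1) by (simp add: trace_comb)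
  have e2: "a = b + \<tau> * d" using z(2) unfolding comb_mult_s trace_comb by Groebner_Basis.algebra
  have e3: "\<tau> * (a + \<tau> * c) = 2 * c + d" using z(3) unfolding comb_mult_t trace_comb by Groebner_Basis.algebra
  have e4: "c = - 2 * d - \<tau> * b" using z(4) unfolding comb_mult_s comb_mult_t trace_comb by Groebner_Basis.algebra
  have "b * (\<tau>\<^sup>2 - 3) = 0" using e1 e2 e4 by Groebner_Basis.algebra
  then have b: "b = 0" using tau by simp
  have "d * (\<tau>\<^sup>2 - 3) = 0" using e2 e3 e4 unfolding b by Groebner_Basis.algebra
  then have "d = 0" using tau by simp
  then show ?thesis using b e2 e4 by simp
qed

lemma comb_inject: "comb a b c d = comb a' b' c' d' \<longleftrightarrow> a = a' \<and> b = b' \<and> c = c' \<and> d = d'"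
proof
  assume *: "comb a b c d = comb a' b' c' d'"
  have "comb (a - a') (b - b') (c - c') (d - d') = comb a b c d - comb a' b' c' d'"
    by (simp add: comb_def mat2_eq_iff algebra_simps)
  then have "comb (a - a') (b - b') (c - c') (d - d') = 0" using * by simp
  from comb_eq_0[OF this] show "a = a' \<and> b = b' \<and> c = c' \<and> d = d'" by simp
qed auto

end

section \<open>The binary polyhedral groups\<close>

text \<open>
  The pair \<open>(x, y)\<close> stands for \<open>x + y\<theta>\<close>, and a quadruple of pairs for the coordinates of a matrix with
  respect to \<open>1, s, t, st\<close>. The argument \<open>tm\<close> is the multiplication by \<open>\<tau> = trace t\<close> on pairs; for \<open>\<tau> = 1\<close>,
  it is the identity and \<open>\<theta>\<close> is arbitrary.
\<close>

type_synonym zquad = "(int \<times> int) \<times> (int \<times> int) \<times> (int \<times> int) \<times> (int \<times> int)"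

datatype letter = S | T

text \<open>The coordinates found in \<open>comb_mult_s\<close> and \<open>comb_mult_t\<close>, with
  \<open>tm\<close> in place of the factor \<tau>.\<close>

fun right_mult :: "(int \<times> int \<Rightarrow> int \<times> int) \<Rightarrow> zquad \<Rightarrow> letter \<Rightarrow> zquad" where
  "right_mult tm (a, b, c, d) S = (- (b + tm (c + d)), a + b + tm c, c + d, - c)"
| "right_mult tm (a, b, c, d) T = (- c, - d, a + tm c, b + tm d)"

definition zword :: "(int \<times> int \<Rightarrow> int \<times> int) \<Rightarrow> letter list \<Rightarrow> zquad" where
  "zword tm w = foldl (right_mult tm) ((1, 0), (0, 0), (0, 0), (0, 0)) w"

text \<open>Exponent 0 is left out because it gives the central element 1, which is common to all
  axes and enters \<open>half_elements\<close> once.\<close>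

definition half_block :: "(int \<times> int \<Rightarrow> int \<times> int) \<Rightarrow> letter list \<times> nat \<Rightarrow> zquad list" where
  "half_block tm = (\<lambda>(w, m). map (\<lambda>j. zword tm (concat (replicate j w))) [1..<m])"

definition half_elements :: "(int \<times> int \<Rightarrow> int \<times> int) \<Rightarrow> (letter list \<times> nat) list \<Rightarrow> zquad list" where
  "half_elements tm D = zword tm [] # concat (map (half_block tm) D)"

definition closed_up_to_sign :: "zquad list \<Rightarrow> (zquad \<Rightarrow> zquad) \<Rightarrow> bool" where
  "closed_up_to_sign E f \<longleftrightarrow> (\<forall>x\<in>set E. f x \<in> set E \<or> - f x \<in> set E)"

definition distinct_up_to_sign :: "zquad list \<Rightarrow> bool" where
  "distinct_up_to_sign E \<longleftrightarrow> distinct (E @ map uminus E)"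

text \<open>One generator per clique is enough to compare: commuting passes through nonscalar
  elements, so a single commuting pair from two cliques would make their generators commute.\<close>

definition noncommuting_axes :: "(int \<times> int \<Rightarrow> int \<times> int) \<Rightarrow> (letter list \<times> nat) list \<Rightarrow> bool" where
  "noncommuting_axes tm D \<longleftrightarrow> sorted_wrt (\<lambda>x y. zword tm (fst x @ fst y) \<noteq> zword tm (fst y @ fst x)) D"

text \<open>
  For each pair \<open>(w, m)\<close> below, the powers \<open>w\<^sup>j\<close> with \<open>j < m\<close> are, up to sign, the elements of a maximal
  cyclic subgroup of order \<open>2m\<close>. The words were found by enumerating the group along its Cayley graph.
\<close>

definition tetra_axes :: "(letter list \<times> nat) list" where
  "tetra_axes = [([S], 3), ([T], 3), ([S, S, T], 3), ([S, T, T], 3), ([S, T], 2), ([T, S], 2),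
    ([S, T, T, S], 2)]"

definition octa_axes :: "(letter list \<times> nat) list" where
  "octa_axes = [([T], 4), ([S, S, T], 4), ([T, S, S], 4), ([S], 3), ([S, T, T], 3),
    ([T, T, S], 3), ([S, T, T, S], 3), ([S, T], 2), ([T, S], 2), ([S, S, T, S, S], 2),
    ([T, S, S, T, T], 2), ([T, T, S, S, T], 2), ([S, T, T, S, S, T], 2)]"

definition icosa_axes :: "(letter list \<times> nat) list" where
  "icosa_axes = [([T], 5), ([S, S, T], 5), ([T, S, S], 5), ([S, S, T, T], 5), ([S, T, T, S], 5),
    ([S, T, T, T], 5), ([S], 3), ([S, T, T], 3), ([T, T, S], 3), ([S, T, T, T, S], 3),
    ([T, S, S, T, T], 3), ([T, T, S, S, T], 3), ([S, S, T, S, S, T, T], 3),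
    ([S, S, T, T, S, S, T], 3), ([T, S, S, T, T, S, S], 3), ([T, S, S, T, T, T, S], 3),
    ([S, T], 2), ([T, S], 2), ([S, S, T, S, S], 2), ([S, T, S, S, T, T], 2),
    ([S, T, T, S, S, T], 2), ([T, S, S, T, T, S], 2), ([T, S, S, T, T, T], 2),
    ([T, T, S, S, T, T], 2), ([S, S, T, S, S, T, T, S, S], 2), ([S, S, T, S, S, T, T, T, S], 2),
    ([S, S, T, T, S, S, T, T, S], 2), ([S, T, T, S, S, T, T, S, S], 2),
    ([T, S, S, T, T, S, S, T, T], 2), ([T, T, S, S, T, T, S, S, T], 2),
    ([S, T, T, S, S, T, T, S, S, T], 2)]"

text \<open>Multiplication by \<theta> when \<theta>^2 = 2.\<close>

definition tau_octa :: "int \<times> int \<Rightarrow> int \<times> int" where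
  "tau_octa = (\<lambda>(x, y). (2 * y, x))"

text \<open>Multiplication by \<theta> when \<theta>^2 = \<theta> + 1.\<close>

definition tau_icosa :: "int \<times> int \<Rightarrow> int \<times> int" where
  "tau_icosa = (\<lambda>(x, y). (y, x + y))"

section \<open>Integer computations for the three lists of axes\<close>

lemma tetra_closed:
  "closed_up_to_sign (half_elements id tetra_axes) (\<lambda>x. right_mult id x S)"
  "closed_up_to_sign (half_elements id tetra_axes) (\<lambda>x. right_mult id x T)"
  by code_simp+

lemma tetra_distinct: "distinct_up_to_sign (half_elements id tetra_axes)"
  by code_simp

lemma tetra_noncommuting: "noncommuting_axes id tetra_axes"
  by code_simp

lemma octa_closed:
  "closed_up_to_sign (half_elements tau_octa octa_axes) (\<lambda>x. right_mult tau_octa x S)"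
  "closed_up_to_sign (half_elements tau_octa octa_axes) (\<lambda>x. right_mult tau_octa x T)"
  by code_simp+

lemma octa_distinct: "distinct_up_to_sign (half_elements tau_octa octa_axes)"
  by code_simp

lemma octa_noncommuting: "noncommuting_axes tau_octa octa_axes"
  by code_simp

lemma icosa_closed:
  "closed_up_to_sign (half_elements tau_icosa icosa_axes) (\<lambda>x. right_mult tau_icosa x S)"
  "closed_up_to_sign (half_elements tau_icosa icosa_axes) (\<lambda>x. right_mult tau_icosa x T)"
  by code_simp+

lemma icosa_distinct: "distinct_up_to_sign (half_elements tau_icosa icosa_axes)"
  by code_simp

lemma icosa_noncommuting: "noncommuting_axes tau_icosa icosa_axes"
  by code_simp

text \<open>For k = 4, 5 both \<theta> and \<tau> will be tr t, of which only a quadratic equation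
  is known, so no particular root is fixed. Irrationality of \<theta> makes the integer pairs
  unique; then different coordinates mean different matrices, and computed inequalities carry
  over.\<close>

locale quaternion_lattice = quaternion_basis s t \<tau> for s t :: "complex^2^2" and \<tau> +
  fixes \<theta> :: complex and tm :: "int \<times> int \<Rightarrow> int \<times> int"
  assumes theta: "\<theta> \<notin> \<rat>"
    and tm: "\<And>x y. of_int (fst (tm (x, y))) + of_int (snd (tm (x, y))) * \<theta> = \<tau> * (of_int x + of_int y * \<theta>)"
begin

definition val :: "int \<times> int \<Rightarrow> complex" where
  "val u = of_int (fst u) + of_int (snd u) * \<theta>"

lemma val_tm: "val (tm u) = \<tau> * val u"
  using tm[of "fst u" "snd u"] by (simp add: val_def)

lemma val_simps: "val (u + v) = val u + val v" "val (u - v) = val u - val v" "val (- u) = - val u" "val (1, 0) = 1" "val (0, 0) = 0"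
  by (simp_all add: val_def algebra_simps)

lemma val_inject: "val u = val v \<longleftrightarrow> u = v"
proof
  assume "val u = val v"
  then have *: "of_int (fst u - fst v) = of_int (snd v - snd u) * \<theta>"
    by (simp add: val_def algebra_simps)
  have "snd v = snd u"
  proof (rule ccontr)
    assume "snd v \<noteq> snd u"
    then have "\<theta> = of_int (fst u - fst v) / of_int (snd v - snd u)"
      unfolding * by simp
    then show False using theta by (metis Rats_divide Rats_of_int)
  qed
  then show "u = v" using * by (simp add: prod_eq_iff)
qed simp

fun mat_of :: "zquad \<Rightarrow> complex^2^2" where
  "mat_of (a, b, c, d) = comb (val a) (val b) (val c) (val d)"

declare mat_of.simps [simp del]

fun gen :: "letter \<Rightarrow> complex^2^2" where
  "gen S = s" | "gen T = t"

definition word_mat :: "letter list \<Rightarrow> complex^2^2" where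
  "word_mat w = foldl (\<lambda>X l. X ** gen l) (mat 1) w"

lemma mat_of_right_mult: "mat_of (right_mult tm q l) = mat_of q ** gen l"
proof -
  obtain a b c d where "q = (a, b, c, d)" by (metis prod_cases4)
  then show ?thesis
    by (cases l) (simp_all add: mat_of.simps comb_mult_s comb_mult_t val_simps val_tm)
qed

lemma mat_of_one: "mat_of ((1, 0), (0, 0), (0, 0), (0, 0)) = mat 1"
  by (simp add: mat_of.simps val_simps comb_def mat2_simps)

lemma mat_of_uminus: "mat_of (- q) = - mat_of q"
proof -
  obtain a b c d where "q = (a, b, c, d)" by (metis prod_cases4)
  then show ?thesis by (simp add: mat_of.simps val_simps comb_def mat2_eq_iff algebra_simps)
qed

lemma mat_of_inject: "mat_of p = mat_of q \<longleftrightarrow> p = q"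
  by (cases p; cases q) (simp add: mat_of.simps comb_inject val_inject)

lemma mat_of_zword: "mat_of (zword tm w) = word_mat w"
proof -
  have "mat_of (foldl (right_mult tm) q w) = foldl (\<lambda>X l. X ** gen l) (mat_of q) w" for q
    by (induction w arbitrary: q) (simp_all add: mat_of_right_mult)
  then show ?thesis by (simp only: zword_def word_mat_def mat_of_one)
qed

lemma word_mat_Nil: "word_mat [] = mat 1"
  by (simp add: word_mat_def)

lemma word_mat_append: "word_mat (u @ v) = word_mat u ** word_mat v"
proof (induction v rule: rev_induct)
  case (snoc l v)
  have "word_mat (w @ [l]) = word_mat w ** gen l" for w by (simp add: word_mat_def)
  from this[of "u @ v"] this[of v] show ?case by (simp add: snoc matrix_mul_assoc)
qed (simp add: word_mat_def)

abbreviation powers_word :: "letter list \<Rightarrow> nat \<Rightarrow> letter list" where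
  "powers_word w j \<equiv> concat (replicate j w)"

lemma word_mat_powers_commute:
  "word_mat (powers_word w j) ** word_mat (powers_word w k) =
   word_mat (powers_word w k) ** word_mat (powers_word w j)"
  by (metis add.commute concat_append replicate_add word_mat_append)

text \<open>The computed facts appear as hypotheses, so that one argument serves three groups.
  \<open>generated\<close> is an induction principle for \<open>H\<close>, and
  \<open>sorted_D\<close> places three largest cliques at the indices 0, 1, 2.\<close>

context
  fixes H :: "(complex^2^2) set" and D :: "(letter list \<times> nat) list"
  assumes H: "subgroup H SL2C" and st: "s \<in> H" "t \<in> H" "- mat 1 \<in> H"
    and generated: "\<forall>X. mat 1 \<in> X \<longrightarrow> (\<forall>x\<in>X. x ** s \<in> X \<and> x ** t \<in> X \<and> - x \<in> X) \<longrightarrow> H \<subseteq> X"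
    and closed: "closed_up_to_sign (half_elements tm D) (\<lambda>x. right_mult tm x S)"
      "closed_up_to_sign (half_elements tm D) (\<lambda>x. right_mult tm x T)"
    and distinct: "distinct_up_to_sign (half_elements tm D)"
    and noncommuting: "noncommuting_axes tm D"
    and orders: "\<forall>x\<in>set D. 2 \<le> snd x"
    and length_D: "3 \<le> length D" and sorted_D: "sorted_wrt (\<ge>) (map snd D)"
begin

lemma H_mult: "x \<in> H \<Longrightarrow> y \<in> H \<Longrightarrow> x ** y \<in> H"
  using subgroup.m_closed[OF H, of x y] by (simp add: SL2C_def)

lemma H_one: "mat 1 \<in> H"
  using subgroup.one_closed[OF H] by (simp add: SL2C_def)

lemma H_uminus: "x \<in> H \<Longrightarrow> - x \<in> H"
  using H_mult[OF st(3), of x] by simp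

lemma word_mat_in_H: "word_mat w \<in> H"
proof (induction w rule: rev_induct)
  case (snoc l w)
  then show ?case
    by (cases l) (simp_all add: word_mat_append H_mult, simp_all add: word_mat_def st H_mult)
qed (simp add: word_mat_def H_one)

definition signed :: "zquad list \<Rightarrow> (complex^2^2) set" where
  "signed E = mat_of ` set (E @ map uminus E)"

lemma signed_iff: "x \<in> signed E \<longleftrightarrow> (\<exists>q\<in>set E. x = mat_of q \<or> x = - mat_of q)"
proof -
  have "signed E = mat_of ` set E \<union> (\<lambda>q. - mat_of q) ` set E"
    by (simp add: signed_def image_Un image_image mat_of_uminus)
  then show ?thesis by blast
qed

lemma signed_append: "signed (E @ F) = signed E \<union> signed F"
  by (simp add: signed_def image_Un Un_ac)

lemma card_signed:
  assumes "distinct_up_to_sign E"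
  shows "card (signed E) = 2 * length E"
proof -
  have "card (signed E) = card (set (E @ map uminus E))"
    unfolding signed_def by (rule card_image) (simp add: inj_on_def mat_of_inject)
  also have "\<dots> = length (E @ map uminus E)"
    by (rule distinct_card) (use assms in \<open>simp add: distinct_up_to_sign_def\<close>)
  finally show ?thesis by simp
qed

lemma distinct_up_to_sign_append:
  assumes "distinct_up_to_sign (E @ F)"
  shows "distinct_up_to_sign E" "distinct_up_to_sign F" "signed E \<inter> signed F = {}"
proof -
  show "distinct_up_to_sign E" "distinct_up_to_sign F"
    using assms by (auto simp: distinct_up_to_sign_def)
  show "signed E \<inter> signed F = {}"
  proof (rule ccontr)
    assume "signed E \<inter> signed F \<noteq> {}"
    then obtain x where x: "x \<in> signed E" "x \<in> signed F" by blast
    from x(1) obtain p where p: "p \<in> set (E @ map uminus E)" "x = mat_of p"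
      unfolding signed_def by blast
    from x(2) obtain q where q: "q \<in> set (F @ map uminus F)" "x = mat_of q"
      unfolding signed_def by blast
    from p(2) q(2) have "p = q" by (simp add: mat_of_inject)
    then show False using p(1) q(1) assms by (auto simp: distinct_up_to_sign_def)
  qed
qed

text \<open>The listed matrices are values of words, hence lie in \<open>H\<close>; with their
  negatives they are closed under the generators, hence exhaust \<open>H\<close>. In this way the
  order of \<open>H\<close> is an outcome of the computation.\<close>

lemma carrier_signed: "H = signed (half_elements tm D)"
proof
  let ?E = "half_elements tm D"
  show "H \<subseteq> signed ?E"
  proof (rule generated[rule_format])
    have "zword tm [] \<in> set ?E" by (simp add: half_elements_def)
    then show "mat 1 \<in> signed ?E"
      unfolding signed_iff using mat_of_zword[of "[]"] word_mat_Nil by metis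
    fix x assume "x \<in> signed ?E"
    then obtain q where q: "q \<in> set ?E" "x = mat_of q \<or> x = - mat_of q" by (auto simp: signed_iff)
    \<comment> \<open>Both signs are claimed because \<open>x\<close> may be the negative of a
      listed matrix.\<close>
    have "mat_of q ** gen l \<in> signed ?E \<and> - (mat_of q ** gen l) \<in> signed ?E" for l
    proof -
      have "right_mult tm q l \<in> set ?E \<or> - right_mult tm q l \<in> set ?E"
        using closed q(1) by (cases l) (auto simp: closed_up_to_sign_def)
      then show ?thesis
        unfolding signed_iff mat_of_right_mult[symmetric] using mat_of_uminus by (metis minus_minus)
    qed
    from this[of S] this[of T] show "x ** s \<in> signed ?E \<and> x ** t \<in> signed ?E \<and> - x \<in> signed ?E"
      using q by (auto simp: signed_iff)
  qed
  have "mat_of q \<in> H" if "q \<in> set ?E" for q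
  proof -
    from that obtain w where "q = zword tm w" by (auto simp: half_elements_def half_block_def)
    then show ?thesis by (simp add: mat_of_zword word_mat_in_H)
  qed
  then show "signed ?E \<subseteq> H" using H_uminus by (auto simp: signed_iff)
qed

definition block :: "nat \<Rightarrow> (complex^2^2) set" where
  "block i = signed (half_block tm (D ! i))"

abbreviation axis :: "nat \<Rightarrow> complex^2^2" where
  "axis i \<equiv> word_mat (fst (D ! i))"

text \<open>Splits the list at one block, so that distinctness of the whole list yields the size of
  the block and its disjointness from the center.\<close>

lemma block_sublist:
  assumes "i < length D"
  obtains E F where "half_elements tm D = (zword tm [] # E) @ half_block tm (D ! i) @ F"
proof -
  have "D = take i D @ D ! i # drop (Suc i) D" using assms by (rule id_take_nth_drop)
  then have "map (half_block tm) D = map (half_block tm) (take i D) @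
      half_block tm (D ! i) # map (half_block tm) (drop (Suc i) D)"
    by (metis list.simps(9) map_append)
  then have "half_elements tm D = (zword tm [] # concat (map (half_block tm) (take i D))) @
      half_block tm (D ! i) @ concat (map (half_block tm) (drop (Suc i) D))"
    by (simp add: half_elements_def)
  then show ?thesis by (rule that)
qed

lemma block_cases:
  assumes "x \<in> block i"
  obtains j where "x = word_mat (powers_word (fst (D ! i)) j) \<or> x = - word_mat (powers_word (fst (D ! i)) j)"
proof -
  obtain q where q: "q \<in> set (half_block tm (D ! i))" "x = mat_of q \<or> x = - mat_of q"
    using assms unfolding block_def signed_iff by blast
  then obtain j where "q = zword tm (powers_word (fst (D ! i)) j)"
    unfolding half_block_def split_beta by (simp only: set_map) blast
  then show ?thesis using q(2) that[of j] by (simp only: mat_of_zword)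
qed

lemma center_signed: "signed [zword tm []] = {mat 1, - mat 1}"
  by (simp add: signed_def mat_of_uminus mat_of_zword word_mat_Nil)

lemma block_disjoint_center:
  assumes "i < length D"
  shows "{mat 1, - mat 1} \<inter> block i = {}"
proof -
  obtain E F where "half_elements tm D = (zword tm [] # E) @ half_block tm (D ! i) @ F"
    using block_sublist[OF assms] .
  then have "half_elements tm D = [zword tm []] @ (E @ half_block tm (D ! i) @ F)" by simp
  then have "signed [zword tm []] \<inter> signed (E @ half_block tm (D ! i) @ F) = {}"
    using distinct distinct_up_to_sign_append(3) by metis
  then show ?thesis by (auto simp: center_signed signed_append block_def)
qed

lemma card_block:
  assumes "i < length D"
  shows "card (block i) = 2 * (snd (D ! i) - 1)"
proof -
  obtain E F where "half_elements tm D = (zword tm [] # E) @ half_block tm (D ! i) @ F"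
    using block_sublist[OF assms] .
  then have "distinct_up_to_sign (half_block tm (D ! i))"
    using distinct distinct_up_to_sign_append(1,2) by metis
  from card_signed[OF this] show ?thesis
    by (simp add: block_def half_block_def split_beta)
qed

lemma block_subset:
  assumes "i < length D"
  shows "block i \<subseteq> H"
proof -
  have "set (half_block tm (D ! i)) \<subseteq> set (half_elements tm D)"
    using assms by (auto simp: half_elements_def)
  then show ?thesis unfolding carrier_signed block_def subset_iff signed_iff by blast
qed

lemma block_nonscalar:
  assumes "i < length D" "x \<in> block i"
  shows "\<not> scalar_mat x"
proof
  assume "scalar_mat x"
  moreover have "det x = 1"
    using block_subset[OF assms(1)] assms(2) subgroup.subset[OF H] by (auto simp: SL2C_def)
  ultimately have "x \<in> {mat 1, - mat 1}" using scalar_mat_det_one by auto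
  then show False using block_disjoint_center[OF assms(1)] assms(2) by blast
qed

lemma block_commute_axis:
  assumes "x \<in> block i"
  shows "x ** axis i = axis i ** x"
proof -
  obtain j where "x = word_mat (powers_word (fst (D ! i)) j) \<or> x = - word_mat (powers_word (fst (D ! i)) j)"
    using block_cases[OF assms] .
  moreover have "word_mat (powers_word (fst (D ! i)) j) ** axis i = axis i ** word_mat (powers_word (fst (D ! i)) j)"
    using word_mat_powers_commute[of j "fst (D ! i)" 1] by simp
  ultimately show ?thesis by (elim disjE) (simp_all only: uminus_mat_mult)
qed

lemma block_commute:
  assumes "x \<in> block i" "y \<in> block i"
  shows "x ** y = y ** x"
proof -
  obtain j where "x = word_mat (powers_word (fst (D ! i)) j) \<or> x = - word_mat (powers_word (fst (D ! i)) j)"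
    using block_cases[OF assms(1)] .
  moreover obtain k where "y = word_mat (powers_word (fst (D ! i)) k) \<or> y = - word_mat (powers_word (fst (D ! i)) k)"
    using block_cases[OF assms(2)] .
  ultimately show ?thesis
    by (elim disjE; hypsubst; simp only: uminus_mat_mult word_mat_powers_commute[of j "fst (D ! i)" k])
qed

lemma axes_noncommuting:
  assumes "i < length D" "j < length D" "i \<noteq> j"
  shows "axis i ** axis j \<noteq> axis j ** axis i"
proof -
  have *: "axis i ** axis j \<noteq> axis j ** axis i" if "i < j" "j < length D" for i j
  proof -
    have "zword tm (fst (D ! i) @ fst (D ! j)) \<noteq> zword tm (fst (D ! j) @ fst (D ! i))"
      using noncommuting that by (simp add: noncommuting_axes_def sorted_wrt_iff_nth_less)
    then show ?thesis by (metis mat_of_inject mat_of_zword word_mat_append)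
  qed
  show ?thesis using *[of i j] *[of j i] assms by (cases "i < j") auto
qed

text \<open>Commuting would be transferred from \<open>x\<close> and \<open>y\<close> to the
  generators of their blocks, first through the nonscalar \<open>x\<close> and then through the
  nonscalar \<open>y\<close>.\<close>

lemma blocks_noncommuting:
  assumes "i < length D" "j < length D" "i \<noteq> j" "x \<in> block i" "y \<in> block j"
  shows "x ** y \<noteq> y ** x"
proof
  assume "x ** y = y ** x"
  then have "axis i ** y = y ** axis i"
    using commute_trans[OF block_nonscalar[OF assms(1,4)] block_commute_axis[OF assms(4)]] by simp
  then have "axis i ** axis j = axis j ** axis i"
    using commute_trans[OF block_nonscalar[OF assms(2,5)] _ block_commute_axis[OF assms(5)]] by metis
  then show False using axes_noncommuting assms by blast
qed

lemma carrier_blocks: "H = {mat 1, - mat 1} \<union> (\<Union>i<length D. block i)"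
proof -
  have "set D = (!) D ` {..<length D}" by (auto simp: set_conv_nth)
  then have "set (half_elements tm D) = {zword tm []} \<union> (\<Union>i<length D. set (half_block tm (D ! i)))"
    by (simp add: half_elements_def)
  then have "x \<in> signed (half_elements tm D) \<longleftrightarrow>
      x \<in> signed [zword tm []] \<or> (\<exists>i\<in>{..<length D}. x \<in> signed (half_block tm (D ! i)))" for x
    unfolding signed_iff by simp
  then show ?thesis
    unfolding carrier_signed center_signed[symmetric] block_def by blast
qed

lemma card_H: "card H = 2 * length (half_elements tm D)"
  unfolding carrier_signed by (rule card_signed) (rule distinct)

lemma commuting_graph_parameters:
  defines "m \<equiv> \<lambda>i. 2 * (snd (D ! i) - 1)"
  shows "radius (commuting_graph (as_group H)) = 1 \<and> diam (commuting_graph (as_group H)) = 2 \<and>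
    detour_radius (commuting_graph (as_group H)) = enat (m 0 + m 1 + 1) \<and>
    detour_diam (commuting_graph (as_group H)) = enat (m 0 + m 1 + m 2 + 1) \<and>
    metric_dimension (commuting_graph (as_group H)) = 2 * length (half_elements tm D) - (length D + 1)"
proof -
  have mono: "m j \<le> m i" if "i \<le> j" "j < length D" for i j
  proof (cases "i = j")
    case False
    then have "map snd D ! i \<ge> map snd D ! j"
      using sorted_D that unfolding sorted_wrt_iff_nth_less by simp
    then show ?thesis using that by (simp add: m_def)
  qed simp
  have card: "card (block i) = m i" if "i < length D" for i using that card_block by (simp add: m_def)
  have one: "mat 1 \<noteq> (- mat 1 :: complex^2^2)" by (simp add: mat2_simps)
  have "radius (commuting_graph (as_group H)) = 1 \<and> diam (commuting_graph (as_group H)) = 2 \<and>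
    detour_radius (commuting_graph (as_group H)) = enat (m 0 + m 1 + 1) \<and>
    detour_diam (commuting_graph (as_group H)) = enat (m 0 + m 1 + m 2 + 1) \<and>
    metric_dimension (commuting_graph (as_group H)) =
      card (carrier (as_group H)) - (card {..<length D} + 1)"
  proof (intro commuting_graph_cliques[where Z = "{mat 1, - mat 1}" and I = "{..<length D}" and B = block
        and ?j1.0 = 0 and ?j2.0 = 1 and ?j3.0 = 2])
    show "carrier (as_group H) = {mat 1, - mat 1} \<union> (\<Union>i<length D. block i)"
      using carrier_blocks by simp
    show "{mat 1, - mat 1} \<inter> block i = {}" if "i \<in> {..<length D}" for i
      using that block_disjoint_center by simp
    show "2 \<le> card (block i)" if "i \<in> {..<length D}" for i
    proof -
      have "2 \<le> snd (D ! i)" using orders that by simp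
      then show ?thesis using that by (simp add: card_block)
    qed
    show "z \<otimes>\<^bsub>as_group H\<^esub> x = x \<otimes>\<^bsub>as_group H\<^esub> z" if "z \<in> {mat 1, - mat 1}" for z x
      using that by (auto simp: SL2C_def)
    show "x \<otimes>\<^bsub>as_group H\<^esub> y = y \<otimes>\<^bsub>as_group H\<^esub> x"
      if "x \<in> block i" "y \<in> block i" for i x y
      using block_commute[OF that] by (simp add: SL2C_def)
    show "x \<otimes>\<^bsub>as_group H\<^esub> y \<noteq> y \<otimes>\<^bsub>as_group H\<^esub> x"
      if "i \<in> {..<length D}" "j \<in> {..<length D}" "i \<noteq> j" "x \<in> block i" "y \<in> block j" for i j x y
      using blocks_noncommuting[of i j x y] that by (simp add: SL2C_def)
    show "card (block i) \<le> m 2" if "i \<in> {..<length D} - {0, 1}" for i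
    proof -
      have "2 \<le> i" using that by auto
      then show ?thesis using that mono[of 2 i] card by simp
    qed
    have "0 < length D" "1 < length D" "2 < length D" using length_D by auto
    then show "card (block 0) = m 0" "card (block 1) = m 1" "card (block 2) = m 2"
      using card by blast+
  qed (use length_D one mono[of 0 1] mono[of 1 2] in auto)
  then show ?thesis by (simp add: card_H)
qed

end

end

section \<open>From the presentation to the traces of the matrices\<close>

abbreviation polyhedral_relations :: "nat \<Rightarrow> (polyhedral_gen word \<times> polyhedral_gen word) set" where
  "polyhedral_relations k \<equiv> {(replicate 2 (Gen_r, True), replicate 3 (Gen_s, True)),
      (replicate 3 (Gen_s, True), replicate k (Gen_t, True)),
      (replicate k (Gen_t, True), [(Gen_r, True), (Gen_s, True), (Gen_t, True)])}"

text \<open>Excludes a collapse of the presentation. Sending s to \<open>p\<close>, t to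
  \<open>q\<close> and r to the involution \<open>p \<circ> q\<close> makes all four words in the
  relations act trivially; the image is a quotient of the rotation group of type (2,3,k).\<close>

lemma binary_polyhedral_noncommuting:
  fixes p q :: "'x \<Rightarrow> 'x"
  assumes k: "0 < k" and p: "p ^^ 3 = id" and q: "q ^^ k = id"
    and pq: "(p \<circ> q) \<circ> (p \<circ> q) = id" and ne: "p \<circ> q \<noteq> q \<circ> p"
  shows "\<not> pres_cong (polyhedral_relations k) [(Gen_s, True), (Gen_t, True)] [(Gen_t, True), (Gen_s, True)]"
proof
  assume *: "pres_cong (polyhedral_relations k) [(Gen_s, True), (Gen_t, True)] [(Gen_t, True), (Gen_s, True)]"
  define g :: "polyhedral_gen \<times> bool \<Rightarrow> 'x \<Rightarrow> 'x" where
    "g = (\<lambda>(x, b). case x of Gen_r \<Rightarrow> p \<circ> q | Gen_s \<Rightarrow> if b then p else p ^^ 2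
      | Gen_t \<Rightarrow> if b then q else q ^^ (k - 1))"
  have inv: "f \<circ> f ^^ (j - 1) = id" "f ^^ (j - 1) \<circ> f = id" if "f ^^ j = id" "0 < j" for f :: "'x \<Rightarrow> 'x" and j
    using that funpow.simps(2)[of "j - 1" f] funpow_Suc_right[of "j - 1" f] by simp_all
  have "word_action g [(Gen_s, True), (Gen_t, True)] = word_action g [(Gen_t, True), (Gen_s, True)]"
  proof (rule pres_cong_word_action[OF *])
    show "g (x, b) \<circ> g (x, \<not> b) = id" for x b
      using inv[OF p] inv[OF q k] pq by (cases x; cases b) (simp_all add: g_def)
    fix u v assume "(u, v) \<in> polyhedral_relations k"
    moreover have "word_action g (replicate 2 (Gen_r, True)) = id" "word_action g (replicate 3 (Gen_s, True)) = id"
      "word_action g (replicate k (Gen_t, True)) = id"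
      using p q pq by (simp_all only: word_action_replicate) (simp_all add: g_def numeral_2_eq_2)
    moreover have "word_action g [(Gen_r, True), (Gen_s, True), (Gen_t, True)] = id"
      using pq by (simp add: g_def comp_assoc)
    ultimately show "word_action g u = word_action g v" by auto
  qed
  then show False using ne by (simp add: g_def)
qed

lemma binary_polyhedral_matrices:
  assumes H: "subgroup H SL2C" and iso: "as_group H \<cong> binary_polyhedral k" and k: "0 < k"
    and nc: "\<not> pres_cong (polyhedral_relations k) [(Gen_s, True), (Gen_t, True)] [(Gen_t, True), (Gen_s, True)]"
  obtains s t where "s \<in> H" "t \<in> H" "- mat 1 \<in> H" "det s = 1" "det t = 1" "trace s = 1" "trace (s ** t) = 0"
    "power_coeffs (trace t) k = (0, -1)"
    "\<forall>X. mat 1 \<in> X \<longrightarrow> (\<forall>x\<in>X. x ** s \<in> X \<and> x ** t \<in> X \<and> - x \<in> X) \<longrightarrow> H \<subseteq> X"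
proof -
  interpret G: group "as_group H" by (rule subgroup.subgroup_is_group[OF H group_SL2C])
  from iso have "as_group H \<cong> presented_group (polyhedral_relations k)" by (simp add: binary_polyhedral_def Let_def)
  then obtain e where "e [] = \<one>\<^bsub>as_group H\<^esub>" "\<And>u v. e (u @ v) = e u \<otimes>\<^bsub>as_group H\<^esub> e v"
    and e_iff: "\<And>u v. e u = e v \<longleftrightarrow> pres_cong (polyhedral_relations k) u v" and "range e = carrier (as_group H)"
    by (rule G.iso_presented_group) blast
  then have e_Nil: "e [] = mat 1" and e_append: "\<And>u v. e (u @ v) = e u ** e v" and range_e: "range e = H"
    by (simp_all add: SL2C_def)
  have in_H: "e u \<in> H" for u using range_e by blast
  have det: "det (e u) = 1" for u
    using in_H[of u] subgroup.subset[OF H] by (auto simp: SL2C_def)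
  have rel: "e u = e v" if "(u, v) \<in> polyhedral_relations k" for u v unfolding e_iff using that by (rule pres_cong.rel)
  have power: "e (replicate j l) = ((\<lambda>X. X ** e [l]) ^^ j) (mat 1)" for j l
  proof (induction j)
    case (Suc j)
    have "e (replicate (Suc j) l) = e (replicate j l) ** e [l]"
      by (metis e_append replicate_Suc replicate_append_same)
    then show ?case using Suc by simp
  qed (simp add: e_Nil)
  have power_commute: "e (replicate j l) ** e [l] = e [l] ** e (replicate j l)" for j l
    by (metis e_append append_Cons append_Nil replicate_append_same)
  define r where "r = e [(Gen_r, True)]"
  define s where "s = e [(Gen_s, True)]"
  define t where "t = e [(Gen_t, True)]"
  define z where "z = e (replicate k (Gen_t, True))"
  have zr: "z = e (replicate 2 (Gen_r, True))" and zs: "z = e (replicate 3 (Gen_s, True))"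
    using rel[of "replicate 3 (Gen_s, True)" "replicate k (Gen_t, True)"]
      rel[of "replicate 2 (Gen_r, True)" "replicate 3 (Gen_s, True)"] by (simp_all add: z_def)
  have "z = e ([(Gen_r, True)] @ [(Gen_s, True)] @ [(Gen_t, True)])"
    using rel[of "replicate k (Gen_t, True)" "[(Gen_r, True), (Gen_s, True), (Gen_t, True)]"] by (simp add: z_def)
  then have zrst: "z = r ** (s ** t)" by (simp only: e_append r_def s_def t_def)
  have "e ([(Gen_s, True)] @ [(Gen_t, True)]) \<noteq> e ([(Gen_t, True)] @ [(Gen_s, True)])"
    using nc by (simp add: e_iff)
  then have st_ne: "s ** t \<noteq> t ** s" by (simp only: e_append s_def t_def not_False_eq_True)
  have "z = r ** r" unfolding zr power by (simp add: numeral_2_eq_2 r_def)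
  then have "r \<otimes>\<^bsub>as_group H\<^esub> r = r \<otimes>\<^bsub>as_group H\<^esub> (s \<otimes>\<^bsub>as_group H\<^esub> t)"
    using zrst by (simp add: SL2C_def)
  then have "r = s \<otimes>\<^bsub>as_group H\<^esub> t"
    using in_H G.m_closed[of s t] by (subst (asm) G.Units_l_cancel) (simp_all add: r_def s_def t_def)
  then have r: "r = s ** t" by (simp add: SL2C_def)
  have cancel: "e [(x, True)] ** e [(x, False)] = mat 1" for x
    using pres_cong.cancel[of "polyhedral_relations k" x True] e_append[of "[(x, True)]" "[(x, False)]"] e_Nil
    by (simp flip: e_iff)
  have nonscalar: "\<not> scalar_mat s" "\<not> scalar_mat t"
    using st_ne scalar_mat_commute by metis+
  \<comment> \<open>A scalar r = st would commute with s, and cancelling s would give st =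
    ts.\<close>
  have "\<not> scalar_mat r"
  proof
    assume "scalar_mat r"
    then have "s ** (s ** t) = s ** (t ** s)"
      using scalar_mat_commute[of r s] by (simp add: r matrix_mul_assoc)
    then have "s \<otimes>\<^bsub>as_group H\<^esub> (s \<otimes>\<^bsub>as_group H\<^esub> t) = s \<otimes>\<^bsub>as_group H\<^esub> (t \<otimes>\<^bsub>as_group H\<^esub> s)"
      by (simp add: SL2C_def)
    then have "s \<otimes>\<^bsub>as_group H\<^esub> t = t \<otimes>\<^bsub>as_group H\<^esub> s"
      using in_H G.m_closed[of s t] G.m_closed[of t s]
      by (subst (asm) G.Units_l_cancel) (simp_all add: s_def t_def)
    then show False using st_ne by (simp add: SL2C_def)
  qed
  \<comment> \<open>\<open>z\<close> is a power of s and a power of t. If it were nonscalar, s and t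
    would commute by \<open>commute_trans\<close>.\<close>
  have "z ** s = s ** z" "z ** t = t ** z"
    using power_commute[of 3 "(Gen_s, True)"] power_commute[of k "(Gen_t, True)"]
    by (simp_all add: s_def t_def zs[symmetric] z_def[symmetric])
  then have "scalar_mat z" using commute_trans[of z s t] st_ne by blast
  then have "z = mat 1 \<or> z = - mat 1" using scalar_mat_det_one det by (simp add: z_def)
  then obtain c where z: "z = scale_mat c (mat 1)" "c = 1 \<or> c = -1"
    by (elim disjE) (force simp: mat2_simps)+
  \<comment> \<open>\<open>power_coeffs x 2\<close> is (x, -1): the first entry gives trace 0 for r,
    the second decides the sign of \<open>z\<close>.\<close>
  have "power_coeffs (trace r) 2 = (0, c)"
    by (rule mat_power_eq_scalar) (use \<open>\<not> scalar_mat r\<close> zr z(1) det in \<open>simp_all add: power r_def\<close>)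
  then have "trace r = 0" and c: "c = -1" by (simp_all add: power_coeffs_def numeral_2_eq_2)
  \<comment> \<open>\<open>power_coeffs x 3\<close> is (x^2 - 1, -x), whose second entry fixes the
    trace of s.\<close>
  have "power_coeffs (trace s) 3 = (0, c)"
    by (rule mat_power_eq_scalar) (use nonscalar zs z(1) det in \<open>simp_all add: power s_def\<close>)
  then have "trace s = 1" by (simp add: power_coeffs_def numeral_3_eq_3 c)
  have "power_coeffs (trace t) k = (0, c)"
    by (rule mat_power_eq_scalar) (use nonscalar z_def z(1) det in \<open>simp_all add: power t_def\<close>)
  have z': "z = - mat 1" using z(1) c by (simp add: mat2_simps)
  \<comment> \<open>A generator with some power equal to -1 has minus the preceding power as its
    inverse. Hence closure under negation makes up for closure under inverses in the last
    conclusion.\<close>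
  have inverse: "e [(x, False)] = - e (replicate j (x, True))"
    if "e (replicate (Suc j) (x, True)) = - mat 1" for x j
  proof -
    have "- e (replicate j (x, True)) ** e [(x, True)] = mat 1"
      using that by (metis e_append minus_minus replicate_Suc replicate_append_same uminus_mat_mult(1))
    then have "- e (replicate j (x, True)) ** (e [(x, True)] ** e [(x, False)]) = e [(x, False)]"
      by (simp only: matrix_mul_assoc matrix_mul_lid)
    then show ?thesis by (simp add: cancel)
  qed
  have "H \<subseteq> X" if one: "mat 1 \<in> X" and step: "\<And>x. x \<in> X \<Longrightarrow> x ** s \<in> X \<and> x ** t \<in> X \<and> - x \<in> X" for X
  proof -
    have powers: "x ** e (replicate j l) \<in> X" if "\<And>x. x \<in> X \<Longrightarrow> x ** e [l] \<in> X" "x \<in> X" for x j l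
      using that(2)
    proof (induction j arbitrary: x)
      case (Suc j)
      have "x ** e (replicate (Suc j) l) = (x ** e [l]) ** e (replicate j l)"
        by (metis append_Cons append_Nil e_append matrix_mul_assoc replicate_Suc)
      then show ?case using Suc that(1) by simp
    qed (simp add: e_Nil)
    have pos: "x ** e [(l, True)] \<in> X" if "x \<in> X" for x l
      using step that step[of "x ** s"]
      by (cases l) (auto simp: r matrix_mul_assoc simp flip: r_def s_def t_def)
    have neg: "x ** e [(l, False)] \<in> X" if "x \<in> X" for x l
    proof -
      have "\<exists>j. e (replicate (Suc j) (l, True)) = - mat 1"
        using zr zs z_def z' k
        by (cases l) (metis numeral_2_eq_2, metis numeral_3_eq_3, metis Suc_pred)
      then obtain j where "e [(l, False)] = - e (replicate j (l, True))" using inverse by blast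
      then have "x ** e [(l, False)] = - (x ** e (replicate j (l, True)))" by simp
      then show ?thesis using powers[OF pos that] step by simp
    qed
    have "e w \<in> X" for w
    proof (induction w rule: rev_induct)
      case (snoc l w)
      then show ?case using pos neg by (cases l; cases "snd l") (auto simp: e_append)
    qed (simp add: e_Nil one)
    then show ?thesis using range_e by blast
  qed
  moreover have "- mat 1 \<in> H" using in_H[of "replicate k (Gen_t, True)"] z' by (simp add: z_def)
  ultimately show ?thesis
    using that[of s t] in_H det \<open>trace s = 1\<close> \<open>trace r = 0\<close> \<open>power_coeffs (trace t) k = (0, c)\<close>
    by (simp add: c r s_def t_def)
qed

text \<open>The multiplicity of p is even in a^2 and odd in p b^2. It is stated for an arbitrary
  complex square root, since the traces are known only through their quadratic equations.\<close>

lemma sqrt_prime_not_Rats: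
  fixes z :: complex
  assumes "z\<^sup>2 = of_nat p" "prime p"
  shows "z \<notin> \<rat>"
proof
  assume "z \<in> \<rat>"
  then obtain a b where z: "z = of_int a / of_int b" "b > 0" by (rule Rats_cases') auto
  then have "of_int a = z * of_int b" by simp
  then have "of_int (a\<^sup>2) = (of_int (int p * b\<^sup>2) :: complex)"
    using assms(1) by (simp add: power_mult_distrib)
  then have ab: "a\<^sup>2 = int p * b\<^sup>2" by (simp only: of_int_eq_iff)
  have p: "prime_elem (int p)" using assms(2) by simp
  then have "a \<noteq> 0" using ab z(2) by auto
  have "2 * multiplicity (int p) a = multiplicity (int p) (a\<^sup>2)"
    using \<open>a \<noteq> 0\<close> p by (simp add: prime_elem_multiplicity_power_distrib)
  also have "\<dots> = Suc (2 * multiplicity (int p) b)"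
    using z(2) p unfolding ab
    by (simp add: prime_elem_multiplicity_mult_distrib prime_elem_multiplicity_power_distrib)
  finally show False by presburger
qed

section \<open>The three binary polyhedral groups\<close>

lemma commuting_graph_binary_tetrahedral:
  assumes H: "subgroup H SL2C" and iso: "as_group H \<cong> binary_tetrahedral"
  shows "let G = commuting_graph (as_group H) in
    radius G = 1 \<and> diam G = 2 \<and> detour_radius G = 9 \<and> detour_diam G = 13 \<and> metric_dimension G = 16"
proof -
  \<comment> \<open>Two 3-cycles of four points whose product is an involution, in the alternating
    group A4.\<close>
  define p :: "nat \<times> nat \<times> nat \<times> nat \<Rightarrow> _" where "p = (\<lambda>(a, b, c, d). (b, c, a, d))"
  define q :: "nat \<times> nat \<times> nat \<times> nat \<Rightarrow> _" where "q = (\<lambda>(a, b, c, d). (a, c, d, b))"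
  have "(p \<circ> q) (0, 1, 2, 3) \<noteq> (q \<circ> p) (0, 1, 2, 3)" by (simp add: p_def q_def)
  then have "p \<circ> q \<noteq> q \<circ> p" by metis
  then have nc: "\<not> pres_cong (polyhedral_relations 3) [(Gen_s, True), (Gen_t, True)] [(Gen_t, True), (Gen_s, True)]"
    by (intro binary_polyhedral_noncommuting[of 3 p q])
      (auto simp: p_def q_def fun_eq_iff eval_nat_numeral)
  obtain s t where st: "s \<in> H" "t \<in> H" "- mat 1 \<in> H" "det s = 1" "det t = 1" "trace s = 1" "trace (s ** t) = 0"
    "power_coeffs (trace t) 3 = (0, -1)"
    "\<forall>X. mat 1 \<in> X \<longrightarrow> (\<forall>x\<in>X. x ** s \<in> X \<and> x ** t \<in> X \<and> - x \<in> X) \<longrightarrow> H \<subseteq> X"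
    using binary_polyhedral_matrices[OF H iso[unfolded binary_tetrahedral_def] _ nc] by auto
  have "trace t = 1" using st(8) by (simp add: power_coeffs_def eval_nat_numeral)
  \<comment> \<open>Here \<tau> = 1, so any irrational number can play the role of \<theta>.\<close>
  have "complex_of_real (sqrt 2) \<notin> \<rat>"
    by (rule sqrt_prime_not_Rats[of _ 2]) (simp_all flip: of_real_power)
  then interpret quaternion_lattice s t 1 "complex_of_real (sqrt 2)" id
    using st(4-7) \<open>trace t = 1\<close> by unfold_locales auto
  have axes: "\<forall>x\<in>set tetra_axes. 2 \<le> snd x" "3 \<le> length tetra_axes" "sorted_wrt (\<ge>) (map snd tetra_axes)"
    by (simp_all add: tetra_axes_def)
  have "length (half_elements id tetra_axes) = 12" by code_simp
  moreover have "length tetra_axes = 7" "snd (tetra_axes ! 0) = 3"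
    "snd (tetra_axes ! 1) = 3" "snd (tetra_axes ! 2) = 3"
    by (simp_all add: tetra_axes_def)
  ultimately show ?thesis
    using commuting_graph_parameters[OF H st(1,2,3,9) tetra_closed tetra_distinct tetra_noncommuting axes]
    by (simp add: Let_def numeral_eq_enat)
qed

lemma commuting_graph_binary_octahedral:
  assumes H: "subgroup H SL2C" and iso: "as_group H \<cong> binary_octahedral"
  shows "let G = commuting_graph (as_group H) in
    radius G = 1 \<and> diam G = 2 \<and> detour_radius G = 13 \<and> detour_diam G = 19 \<and> metric_dimension G = 34"
proof -
  \<comment> \<open>A 3-cycle and a 4-cycle of four points whose product is an involution, in the
    symmetric group S4.\<close>
  define p :: "nat \<times> nat \<times> nat \<times> nat \<Rightarrow> _" where "p = (\<lambda>(a, b, c, d). (b, c, a, d))"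
  define q :: "nat \<times> nat \<times> nat \<times> nat \<Rightarrow> _" where "q = (\<lambda>(a, b, c, d). (c, a, d, b))"
  have "(p \<circ> q) (0, 1, 2, 3) \<noteq> (q \<circ> p) (0, 1, 2, 3)" by (simp add: p_def q_def)
  then have "p \<circ> q \<noteq> q \<circ> p" by metis
  then have nc: "\<not> pres_cong (polyhedral_relations 4) [(Gen_s, True), (Gen_t, True)] [(Gen_t, True), (Gen_s, True)]"
    by (intro binary_polyhedral_noncommuting[of 4 p q])
      (auto simp: p_def q_def fun_eq_iff eval_nat_numeral)
  obtain s t where st: "s \<in> H" "t \<in> H" "- mat 1 \<in> H" "det s = 1" "det t = 1" "trace s = 1" "trace (s ** t) = 0"
    "power_coeffs (trace t) 4 = (0, -1)"
    "\<forall>X. mat 1 \<in> X \<longrightarrow> (\<forall>x\<in>X. x ** s \<in> X \<and> x ** t \<in> X \<and> - x \<in> X) \<longrightarrow> H \<subseteq> X"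
    using binary_polyhedral_matrices[OF H iso[unfolded binary_octahedral_def] _ nc] by auto
  \<comment> \<open>\<open>power_coeffs x 4\<close> is (x^3 - 2x, 1 - x^2), and the second entry is
    -1.\<close>
  have tt: "trace t * trace t = 2"
    using st(8) by (simp add: power_coeffs_def eval_nat_numeral algebra_simps)
  then have "trace t \<notin> \<rat>"
    by (intro sqrt_prime_not_Rats[of _ 2]) (simp_all add: power2_eq_square)
  then interpret quaternion_lattice s t "trace t" "trace t" tau_octa
    using st(4-7) tt by unfold_locales (auto simp: power2_eq_square tau_octa_def algebra_simps)
  have axes: "\<forall>x\<in>set octa_axes. 2 \<le> snd x" "3 \<le> length octa_axes" "sorted_wrt (\<ge>) (map snd octa_axes)"
    by (simp_all add: octa_axes_def)
  have "length (half_elements tau_octa octa_axes) = 24" by code_simp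
  moreover have "length octa_axes = 13" "snd (octa_axes ! 0) = 4"
    "snd (octa_axes ! 1) = 4" "snd (octa_axes ! 2) = 4"
    by (simp_all add: octa_axes_def)
  ultimately show ?thesis
    using commuting_graph_parameters[OF H st(1,2,3,9) octa_closed octa_distinct octa_noncommuting axes]
    by (simp add: Let_def numeral_eq_enat)
qed

lemma commuting_graph_binary_icosahedral:
  assumes H: "subgroup H SL2C" and iso: "as_group H \<cong> binary_icosahedral"
  shows "let G = commuting_graph (as_group H) in
    radius G = 1 \<and> diam G = 2 \<and> detour_radius G = 17 \<and> detour_diam G = 25 \<and> metric_dimension G = 88"
proof -
  \<comment> \<open>A 3-cycle and a 5-cycle of five points whose product is an involution, in the
    alternating group A5.\<close>
  define p :: "nat \<times> nat \<times> nat \<times> nat \<times> nat \<Rightarrow> _" where "p = (\<lambda>(a, b, c, d, e). (b, c, a, d, e))"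
  define q :: "nat \<times> nat \<times> nat \<times> nat \<times> nat \<Rightarrow> _" where "q = (\<lambda>(a, b, c, d, e). (c, d, e, a, b))"
  have "(p \<circ> q) (0, 1, 2, 3, 4) \<noteq> (q \<circ> p) (0, 1, 2, 3, 4)" by (simp add: p_def q_def)
  then have "p \<circ> q \<noteq> q \<circ> p" by metis
  then have nc: "\<not> pres_cong (polyhedral_relations 5) [(Gen_s, True), (Gen_t, True)] [(Gen_t, True), (Gen_s, True)]"
    by (intro binary_polyhedral_noncommuting[of 5 p q])
      (auto simp: p_def q_def fun_eq_iff eval_nat_numeral)
  obtain s t where st: "s \<in> H" "t \<in> H" "- mat 1 \<in> H" "det s = 1" "det t = 1" "trace s = 1" "trace (s ** t) = 0"
    "power_coeffs (trace t) 5 = (0, -1)"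
    "\<forall>X. mat 1 \<in> X \<longrightarrow> (\<forall>x\<in>X. x ** s \<in> X \<and> x ** t \<in> X \<and> - x \<in> X) \<longrightarrow> H \<subseteq> X"
    using binary_polyhedral_matrices[OF H iso[unfolded binary_icosahedral_def] _ nc] by auto
  \<comment> \<open>\<open>power_coeffs x 5\<close> is (x^4 - 3x^2 + 1, 2x - x^3). From x^3 = 2x + 1
    follows x^4 = 2x^2 + x, and the first entry becomes -x^2 + x + 1 = 0.\<close>
  have tt: "trace t * trace t = trace t + 1"
    using st(8) by (simp add: power_coeffs_def eval_nat_numeral) Groebner_Basis.algebra
  \<comment> \<open>The discriminant of x^2 = x + 1 is 5, and 2x - 1 is a square root of it.\<close>
  have "2 * trace t - 1 \<notin> \<rat>"
  proof (rule sqrt_prime_not_Rats)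
    show "(2 * trace t - 1)\<^sup>2 = of_nat 5" using tt by simp Groebner_Basis.algebra
  qed simp
  then have irr: "trace t \<notin> \<rat>" by (metis Rats_1 Rats_diff Rats_mult Rats_number_of)
  \<comment> \<open>Together with \<open>tt\<close> this would give tr t = 2, which is
    rational.\<close>
  have "(trace t)\<^sup>2 \<noteq> 3"
  proof
    assume *: "(trace t)\<^sup>2 = 3"
    then have "trace t = 2" using tt by (simp add: power2_eq_square)
    then show False using irr by simp
  qed
  have "of_int (fst (tau_icosa (x, y))) + of_int (snd (tau_icosa (x, y))) * trace t =
      trace t * (of_int x + of_int y * trace t)" for x y
    using tt by (simp add: tau_icosa_def) Groebner_Basis.algebra
  then interpret quaternion_lattice s t "trace t" "trace t" tau_icosa
    using st(4-7) irr \<open>(trace t)\<^sup>2 \<noteq> 3\<close> by unfold_locales simp_all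
  have axes: "\<forall>x\<in>set icosa_axes. 2 \<le> snd x" "3 \<le> length icosa_axes" "sorted_wrt (\<ge>) (map snd icosa_axes)"
    by (simp_all add: icosa_axes_def)
  have "length (half_elements tau_icosa icosa_axes) = 60" by code_simp
  moreover have "length icosa_axes = 31" "snd (icosa_axes ! 0) = 5"
    "snd (icosa_axes ! 1) = 5" "snd (icosa_axes ! 2) = 5"
    by (simp_all add: icosa_axes_def)
  ultimately show ?thesis
    using commuting_graph_parameters[OF H st(1,2,3,9) icosa_closed icosa_distinct icosa_noncommuting axes]
    by (simp add: Let_def numeral_eq_enat)
qed

text \<open>For n = 1 the graph is a single vertex, whose eccentricity is the supremum of the empty
  set, that is 0. Therefore radius and diameter of the cyclic row are claimed from n = 2 on, while
  the values n - 1 are correct for n = 1 too.\<close>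

theorem theorem4p5:
  fixes H :: "(complex^2^2) set"
  assumes "subgroup H SL2C" and "finite H"
  shows "let G = commuting_graph (as_group H) in
    (\<forall>n\<ge>1. as_group H \<cong> integer_mod_group n \<longrightarrow>
       (n \<ge> 2 \<longrightarrow> radius G = 1 \<and> diam G = 1) \<and>
       detour_radius G = enat (n - 1) \<and> detour_diam G = enat (n - 1) \<and>
       metric_dimension G = n - 1) \<and>
    (\<forall>n\<ge>2. as_group H \<cong> binary_dihedral n \<longrightarrow>
       radius G = 1 \<and> diam G = 2 \<and>
       detour_radius G = enat (2 * n + 1) \<and> detour_diam G = enat (2 * n + 3) \<and>
       metric_dimension G = 3 * n - 2) \<and>
    (as_group H \<cong> binary_tetrahedral \<longrightarrow>
       radius G = 1 \<and> diam G = 2 \<and> detour_radius G = 9 \<and> detour_diam G = 13 \<and>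
       metric_dimension G = 16) \<and>
    (as_group H \<cong> binary_octahedral \<longrightarrow>
       radius G = 1 \<and> diam G = 2 \<and> detour_radius G = 13 \<and> detour_diam G = 19 \<and>
       metric_dimension G = 34) \<and>
    (as_group H \<cong> binary_icosahedral \<longrightarrow>
       radius G = 1 \<and> diam G = 2 \<and> detour_radius G = 17 \<and> detour_diam G = 25 \<and>
       metric_dimension G = 88)"
proof -
  interpret group "as_group H" by (rule subgroup.subgroup_is_group[OF assms(1) group_SL2C])
  let ?G = "commuting_graph (as_group H)"
  have cyclic: "(n \<ge> 2 \<longrightarrow> radius ?G = 1 \<and> diam ?G = 1) \<and> detour_radius ?G = enat (n - 1) \<and>
      detour_diam ?G = enat (n - 1) \<and> metric_dimension ?G = n - 1"
    if n: "1 \<le> n" and iso: "as_group H \<cong> integer_mod_group n" for n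
  proof -
    obtain f where f: "f \<in> iso (as_group H) (integer_mod_group n)" using iso by (auto simp: is_iso_def)
    then have hom: "f \<in> hom (as_group H) (integer_mod_group n)"
      and bij: "bij_betw f (carrier (as_group H)) (carrier (integer_mod_group n))"
      by (auto simp: iso_def)
    have card: "card (carrier (as_group H)) = n"
      using bij_betw_same_card[OF bij] n by (simp add: carrier_integer_mod_group)
    have comm: "x \<otimes>\<^bsub>as_group H\<^esub> y = y \<otimes>\<^bsub>as_group H\<^esub> x"
      if "x \<in> carrier (as_group H)" "y \<in> carrier (as_group H)" for x y
    proof (rule inj_onD[OF bij_betw_imp_inj_on[OF bij]])
      show "f (x \<otimes>\<^bsub>as_group H\<^esub> y) = f (y \<otimes>\<^bsub>as_group H\<^esub> x)"
        using that by (simp only: hom_mult[OF hom]) (simp add: add.commute)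
    qed (use that m_closed in blast)+
    have fin: "finite (carrier (as_group H))" "carrier (as_group H) \<noteq> {}" using assms(2) one_closed by auto
    show ?thesis
      using commuting_graph_commutative[OF fin comm] unfolding card by blast
  qed
  show ?thesis
    unfolding Let_def
    using cyclic commuting_graph_binary_dihedral
      commuting_graph_binary_tetrahedral[OF assms(1), unfolded Let_def]
      commuting_graph_binary_octahedral[OF assms(1), unfolded Let_def]
      commuting_graph_binary_icosahedral[OF assms(1), unfolded Let_def]
    by blast
qed

end
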